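(* Let $n\ge1$ and $0<\varepsilon<1$. The data $(\mathcal E,S)$ defines an odd unbounded Kasparov cycle between $C(\mathbb{S}^n)$ and $C_0(\mathbb{R}^{n+1})$.
   Context: In spherical coordinates on $\mathbb{R}^{n+1}\setminus\{0\}$ let $\tilde\imath:\mathbb{S}^n\times(-\varepsilon,\varepsilon)\to\mathbb{R}^{n+1}$, $\tilde\imath(\vec\theta,s)=(\vec\theta,s+1)$ (the point of radius $r=s+1$ in direction $\vec\theta$). $\mathcal E$ is the vector space $C_0(\mathbb{S}^n\times(-\varepsilon,\varepsilon))$ with the $C_0(\mathbb{R}^{n+1})$-valued sesquilinear form $$\langle\psi,\phi\rangle_{\mathcal E}(\vec\theta,r)=\begin{cases}\frac1{r^n}\overline{\psi}(\tilde\imath^{-1}(\vec\theta,r))\,\phi(\tilde\imath^{-1}(\vec\theta,r)),&(\vec\theta,r)\in\tilde\imath(\mathbb{S}^n\times(-\varepsilon,\varepsilon)),\\0,&\text{otherwise,}\end{cases}$$ and left and right actions $(g\cdot\psi\cdot h)(\vec\theta,s)=g(\vec\theta)\psi(\vec\theta,s)h(\tilde\imath(\vec\theta,s))$ for $g\in C(\mathbb{S}^n)$, $h\in C_0(\mathbb{R}^{n+1})$. With $\alpha=\frac{\pi}{2\varepsilon}$ and $f(s)=\alpha\tan(\alpha s)$, $S$ is the operator $(S\psi)(\theta,s)=f(s)\psi(\theta,s)$ on $\mathrm{dom}(S)=\{\psi\in\mathcal E: f\psi\in\mathcal E\}$. An odd unbounded Kasparov $A$-$B$ cycle is a Hilbert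 $B$-module with left $A$-action by adjointable operators, and a self-adjoint regular operator on it with resolvent compact (after multiplication by elements of $A$) and bounded commutators with a dense $*$-subalgebra of $A$; no grading is required. *)

theory Defs
  imports "HOL-Analysis.Analysis" "HOL-Library.Function_Algebras"
begin

section \<open>C*-algebras and Hilbert C*-modules\<close>

text \<open>
  Algebras and modules are carrier sets inside an ambient type that supplies addition (and, for
  algebras, multiplication). Scalar multiplication, involution, norm, module action and inner
  product are record fields, constrained only on the carrier, except that the scalar multiplication
  makes the whole ambient type a complex vector space. C*-algebras need not be unital.
\<close>

record 'a star_alg =
  alg_carrier :: "'a set"
  alg_scale :: "complex \<Rightarrow> 'a \<Rightarrow> 'a"
  alg_star :: "'a \<Rightarrow> 'a"
  alg_norm :: "'a \<Rightarrow> real"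

definition complete_wrt :: "('v \<Rightarrow> real) \<Rightarrow> 'v::ab_group_add set \<Rightarrow> bool" where
  "complete_wrt nrm V \<longleftrightarrow>
     (\<forall>X :: nat \<Rightarrow> 'v.
        (\<forall>k. X k \<in> V) \<and> (\<forall>e>0. \<exists>N. \<forall>m\<ge>N. \<forall>k\<ge>N. nrm (X m - X k) < e) \<longrightarrow>
        (\<exists>l\<in>V. (\<lambda>k. nrm (X k - l)) \<longlonglongrightarrow> 0))"

definition dense_wrt :: "('v \<Rightarrow> real) \<Rightarrow> 'v::ab_group_add set \<Rightarrow> 'v set \<Rightarrow> bool" where
  "dense_wrt nrm V W \<longleftrightarrow> W \<subseteq> V \<and> (\<forall>v\<in>V. \<forall>e>0. \<exists>w\<in>W. nrm (v - w) < e)"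

locale cstar_algebra = vector_space "alg_scale A" for A :: "'a::ring star_alg" +
  assumes carrier_subspace: "subspace (alg_carrier A)"
    and mult_closed: "\<lbrakk>a \<in> alg_carrier A; b \<in> alg_carrier A\<rbrakk> \<Longrightarrow> a * b \<in> alg_carrier A"
    and scale_mult_left: "\<lbrakk>a \<in> alg_carrier A; b \<in> alg_carrier A\<rbrakk> \<Longrightarrow>
          alg_scale A c a * b = alg_scale A c (a * b)"
    and scale_mult_right: "\<lbrakk>a \<in> alg_carrier A; b \<in> alg_carrier A\<rbrakk> \<Longrightarrow>
          a * alg_scale A c b = alg_scale A c (a * b)"
    and star_closed: "a \<in> alg_carrier A \<Longrightarrow> alg_star A a \<in> alg_carrier A"
    and star_star: "a \<in> alg_carrier A \<Longrightarrow> alg_star A (alg_star A a) = a"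
    and star_add: "\<lbrakk>a \<in> alg_carrier A; b \<in> alg_carrier A\<rbrakk> \<Longrightarrow>
          alg_star A (a + b) = alg_star A a + alg_star A b"
    and star_scale: "a \<in> alg_carrier A \<Longrightarrow>
          alg_star A (alg_scale A c a) = alg_scale A (cnj c) (alg_star A a)"
    and star_mult: "\<lbrakk>a \<in> alg_carrier A; b \<in> alg_carrier A\<rbrakk> \<Longrightarrow>
          alg_star A (a * b) = alg_star A b * alg_star A a"
    and norm_nonneg: "a \<in> alg_carrier A \<Longrightarrow> 0 \<le> alg_norm A a"
    and norm_eq_0: "a \<in> alg_carrier A \<Longrightarrow> alg_norm A a = 0 \<longleftrightarrow> a = 0"
    and norm_scale: "a \<in> alg_carrier A \<Longrightarrow> alg_norm A (alg_scale A c a) = cmod c * alg_norm A a"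
    and norm_triangle: "\<lbrakk>a \<in> alg_carrier A; b \<in> alg_carrier A\<rbrakk> \<Longrightarrow>
          alg_norm A (a + b) \<le> alg_norm A a + alg_norm A b"
    and norm_mult: "\<lbrakk>a \<in> alg_carrier A; b \<in> alg_carrier A\<rbrakk> \<Longrightarrow>
          alg_norm A (a * b) \<le> alg_norm A a * alg_norm A b"
    and cstar_identity: "a \<in> alg_carrier A \<Longrightarrow> alg_norm A (alg_star A a * a) = (alg_norm A a)\<^sup>2"
    and complete: "complete_wrt (alg_norm A) (alg_carrier A)"
begin

definition positive :: "'a \<Rightarrow> bool" where
  "positive a \<longleftrightarrow> (\<exists>c\<in>alg_carrier A. a = alg_star A c * c)"

definition dense_star_subalgebra :: "'a set \<Rightarrow> bool" where
  "dense_star_subalgebra \<A> \<longleftrightarrow>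
     subspace \<A> \<and> (\<forall>a\<in>\<A>. \<forall>b\<in>\<A>. a * b \<in> \<A>) \<and> (\<forall>a\<in>\<A>. alg_star A a \<in> \<A>) \<and>
     dense_wrt (alg_norm A) (alg_carrier A) \<A>"

end

record ('e, 'b) right_module =
  mod_carrier :: "'e set"
  mod_scale :: "complex \<Rightarrow> 'e \<Rightarrow> 'e"
  mod_act :: "'e \<Rightarrow> 'b \<Rightarrow> 'e"
  mod_ip :: "'e \<Rightarrow> 'e \<Rightarrow> 'b"

text \<open>The inner product is linear in the second and conjugate linear in the first variable.\<close>

locale hilbert_module = B: cstar_algebra B + E: vector_space "mod_scale E"
  for B :: "'b::ring star_alg" and E :: "('e::ab_group_add, 'b) right_module" +
  assumes mod_subspace: "E.subspace (mod_carrier E)"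
    and act_closed: "\<lbrakk>\<psi> \<in> mod_carrier E; b \<in> alg_carrier B\<rbrakk> \<Longrightarrow> mod_act E \<psi> b \<in> mod_carrier E"
    and act_add_left: "\<lbrakk>\<psi> \<in> mod_carrier E; \<phi> \<in> mod_carrier E; b \<in> alg_carrier B\<rbrakk> \<Longrightarrow>
          mod_act E (\<psi> + \<phi>) b = mod_act E \<psi> b + mod_act E \<phi> b"
    and act_add_right: "\<lbrakk>\<psi> \<in> mod_carrier E; b \<in> alg_carrier B; b' \<in> alg_carrier B\<rbrakk> \<Longrightarrow>
          mod_act E \<psi> (b + b') = mod_act E \<psi> b + mod_act E \<psi> b'"
    and act_scale_left: "\<lbrakk>\<psi> \<in> mod_carrier E; b \<in> alg_carrier B\<rbrakk> \<Longrightarrow>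
          mod_act E (mod_scale E c \<psi>) b = mod_scale E c (mod_act E \<psi> b)"
    and act_scale_right: "\<lbrakk>\<psi> \<in> mod_carrier E; b \<in> alg_carrier B\<rbrakk> \<Longrightarrow>
          mod_act E \<psi> (alg_scale B c b) = mod_scale E c (mod_act E \<psi> b)"
    and act_mult: "\<lbrakk>\<psi> \<in> mod_carrier E; b \<in> alg_carrier B; b' \<in> alg_carrier B\<rbrakk> \<Longrightarrow>
          mod_act E (mod_act E \<psi> b) b' = mod_act E \<psi> (b * b')"
    and ip_closed: "\<lbrakk>\<psi> \<in> mod_carrier E; \<phi> \<in> mod_carrier E\<rbrakk> \<Longrightarrow> mod_ip E \<psi> \<phi> \<in> alg_carrier B"
    and ip_add: "\<lbrakk>\<psi> \<in> mod_carrier E; \<phi> \<in> mod_carrier E; \<xi> \<in> mod_carrier E\<rbrakk> \<Longrightarrow>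
          mod_ip E \<psi> (\<phi> + \<xi>) = mod_ip E \<psi> \<phi> + mod_ip E \<psi> \<xi>"
    and ip_scale: "\<lbrakk>\<psi> \<in> mod_carrier E; \<phi> \<in> mod_carrier E\<rbrakk> \<Longrightarrow>
          mod_ip E \<psi> (mod_scale E c \<phi>) = alg_scale B c (mod_ip E \<psi> \<phi>)"
    and ip_act: "\<lbrakk>\<psi> \<in> mod_carrier E; \<phi> \<in> mod_carrier E; b \<in> alg_carrier B\<rbrakk> \<Longrightarrow>
          mod_ip E \<psi> (mod_act E \<phi> b) = mod_ip E \<psi> \<phi> * b"
    and ip_star: "\<lbrakk>\<psi> \<in> mod_carrier E; \<phi> \<in> mod_carrier E\<rbrakk> \<Longrightarrow>
          alg_star B (mod_ip E \<psi> \<phi>) = mod_ip E \<phi> \<psi>"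
    and ip_positive: "\<psi> \<in> mod_carrier E \<Longrightarrow> B.positive (mod_ip E \<psi> \<psi>)"
    and ip_definite: "\<lbrakk>\<psi> \<in> mod_carrier E; mod_ip E \<psi> \<psi> = 0\<rbrakk> \<Longrightarrow> \<psi> = 0"
    and mod_complete: "complete_wrt (\<lambda>\<psi>. sqrt (alg_norm B (mod_ip E \<psi> \<psi>))) (mod_carrier E)"
begin

definition mnorm :: "'e \<Rightarrow> real" where
  "mnorm \<psi> = sqrt (alg_norm B (mod_ip E \<psi> \<psi>))"


subsection \<open>Adjointable and compact operators\<close>

text \<open>The existence of an adjoint forces boundedness and linearity over the algebra.\<close>

definition adjoint_pair :: "('e \<Rightarrow> 'e) \<Rightarrow> ('e \<Rightarrow> 'e) \<Rightarrow> bool" where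
  "adjoint_pair T T' \<longleftrightarrow>
     T ` mod_carrier E \<subseteq> mod_carrier E \<and> T' ` mod_carrier E \<subseteq> mod_carrier E \<and>
     (\<forall>\<psi>\<in>mod_carrier E. \<forall>\<phi>\<in>mod_carrier E. mod_ip E (T \<psi>) \<phi> = mod_ip E \<psi> (T' \<phi>))"

definition adjointable :: "('e \<Rightarrow> 'e) \<Rightarrow> bool" where
  "adjointable T \<longleftrightarrow> (\<exists>T'. adjoint_pair T T')"

definition rank_one :: "'e \<Rightarrow> 'e \<Rightarrow> 'e \<Rightarrow> 'e" where
  "rank_one \<psi> \<phi> \<xi> = mod_act E \<psi> (mod_ip E \<phi> \<xi>)"

text \<open>Compactness in the sense of Hilbert modules: the operator norm closure of the span of the
  rank one operators. (Scalars are absorbed into the first argument of \<open>rank_one\<close>.)\<close>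

definition compact_op :: "('e \<Rightarrow> 'e) \<Rightarrow> bool" where
  "compact_op T \<longleftrightarrow> adjointable T \<and>
     (\<forall>e>0. \<exists>(m::nat) u v. (\<forall>i<m. u i \<in> mod_carrier E \<and> v i \<in> mod_carrier E) \<and>
        (\<forall>\<xi>\<in>mod_carrier E. mnorm (T \<xi> - (\<Sum>i<m. rank_one (u i) (v i) \<xi>)) \<le> e * mnorm \<xi>))"


subsection \<open>Unbounded operators\<close>

text \<open>An unbounded operator is a pair of a domain and a function, relevant only on the domain.\<close>

definition module_operator :: "'e set \<Rightarrow> ('e \<Rightarrow> 'e) \<Rightarrow> bool" where
  "module_operator domD D \<longleftrightarrow>
     E.subspace domD \<and> domD \<subseteq> mod_carrier E \<and> D ` domD \<subseteq> mod_carrier E \<and>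
     (\<forall>\<psi>\<in>domD. \<forall>b\<in>alg_carrier B. mod_act E \<psi> b \<in> domD \<and> D (mod_act E \<psi> b) = mod_act E (D \<psi>) b) \<and>
     (\<forall>\<psi>\<in>domD. \<forall>\<phi>\<in>domD. D (\<psi> + \<phi>) = D \<psi> + D \<phi>) \<and>
     (\<forall>\<psi>\<in>domD. \<forall>c. D (mod_scale E c \<psi>) = mod_scale E c (D \<psi>))"

definition densely_defined :: "'e set \<Rightarrow> bool" where
  "densely_defined domD \<longleftrightarrow> dense_wrt mnorm (mod_carrier E) domD"

definition op_graph :: "'e set \<Rightarrow> ('e \<Rightarrow> 'e) \<Rightarrow> ('e \<times> 'e) set" where
  "op_graph domD D = (\<lambda>\<psi>. (\<psi>, D \<psi>)) ` domD"

definition closed_op :: "'e set \<Rightarrow> ('e \<Rightarrow> 'e) \<Rightarrow> bool" where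
  "closed_op domD D \<longleftrightarrow>
     (\<forall>X \<psi> \<eta>. (\<forall>k::nat. X k \<in> domD) \<and> \<psi> \<in> mod_carrier E \<and> \<eta> \<in> mod_carrier E \<and>
        (\<lambda>k. mnorm (X k - \<psi>)) \<longlonglongrightarrow> 0 \<and> (\<lambda>k. mnorm (D (X k) - \<eta>)) \<longlonglongrightarrow> 0 \<longrightarrow>
        (\<psi>, \<eta>) \<in> op_graph domD D)"

text \<open>The graph of the adjoint, single valued when \<open>domD\<close> is dense.\<close>

definition adjoint_graph :: "'e set \<Rightarrow> ('e \<Rightarrow> 'e) \<Rightarrow> ('e \<times> 'e) set" where
  "adjoint_graph domD D = {(\<phi>, \<eta>). \<phi> \<in> mod_carrier E \<and> \<eta> \<in> mod_carrier E \<and>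
     (\<forall>\<psi>\<in>domD. mod_ip E (D \<psi>) \<phi> = mod_ip E \<psi> \<eta>)}"

definition self_adjoint :: "'e set \<Rightarrow> ('e \<Rightarrow> 'e) \<Rightarrow> bool" where
  "self_adjoint domD D \<longleftrightarrow>
     module_operator domD D \<and> densely_defined domD \<and> op_graph domD D = adjoint_graph domD D"

text \<open>Regularity: closed, densely defined, densely defined adjoint, and \<open>1 + D\<^sup>*D\<close> of dense range.\<close>

definition regular :: "'e set \<Rightarrow> ('e \<Rightarrow> 'e) \<Rightarrow> bool" where
  "regular domD D \<longleftrightarrow>
     module_operator domD D \<and> closed_op domD D \<and> densely_defined domD \<and>
     densely_defined (fst ` adjoint_graph domD D) \<and>
     dense_wrt mnorm (mod_carrier E)
       {\<psi> + \<eta> |\<psi> \<eta>. \<psi> \<in> domD \<and> (D \<psi>, \<eta>) \<in> adjoint_graph domD D}"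

definition is_resolvent :: "'e set \<Rightarrow> ('e \<Rightarrow> 'e) \<Rightarrow> complex \<Rightarrow> ('e \<Rightarrow> 'e) \<Rightarrow> bool" where
  "is_resolvent domD D z R \<longleftrightarrow> adjointable R \<and> R ` mod_carrier E \<subseteq> domD \<and>
     (\<forall>\<phi>\<in>mod_carrier E. D (R \<phi>) - mod_scale E z (R \<phi>) = \<phi>) \<and>
     (\<forall>\<psi>\<in>domD. R (D \<psi> - mod_scale E z \<psi>) = \<psi>)"

end


section \<open>Odd unbounded Kasparov cycles\<close>

text \<open>
  The commutator \<open>[D, a]\<close> is defined on the domain of \<open>D\<close>, which \<open>a\<close> has to preserve.
  The resolvent condition is imposed at every non-real point; a self-adjoint regular operator has
  all of these in its resolvent set, and compactness at one of them implies it at the others.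
\<close>

locale odd_unbounded_kasparov_cycle = A: cstar_algebra A + hilbert_module B E
  for A :: "'a::ring star_alg" and B :: "'b::ring star_alg"
    and E :: "('e::ab_group_add, 'b) right_module" +
  fixes lact :: "'a \<Rightarrow> 'e \<Rightarrow> 'e" and domD :: "'e set" and D :: "'e \<Rightarrow> 'e"
  assumes lact_adjoint: "a \<in> alg_carrier A \<Longrightarrow> adjoint_pair (lact a) (lact (alg_star A a))"
    and lact_add: "\<lbrakk>a \<in> alg_carrier A; a' \<in> alg_carrier A; \<psi> \<in> mod_carrier E\<rbrakk> \<Longrightarrow>
          lact (a + a') \<psi> = lact a \<psi> + lact a' \<psi>"
    and lact_scale: "\<lbrakk>a \<in> alg_carrier A; \<psi> \<in> mod_carrier E\<rbrakk> \<Longrightarrow>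
          lact (alg_scale A c a) \<psi> = mod_scale E c (lact a \<psi>)"
    and lact_mult: "\<lbrakk>a \<in> alg_carrier A; a' \<in> alg_carrier A; \<psi> \<in> mod_carrier E\<rbrakk> \<Longrightarrow>
          lact (a * a') \<psi> = lact a (lact a' \<psi>)"
    and self_adjoint: "self_adjoint domD D"
    and regular: "regular domD D"
    and compact_resolvent: "Im z \<noteq> 0 \<Longrightarrow>
          \<exists>R. is_resolvent domD D z R \<and> (\<forall>a\<in>alg_carrier A. compact_op (\<lambda>\<psi>. lact a (R \<psi>)))"
    and bounded_commutators: "\<exists>\<A>. A.dense_star_subalgebra \<A> \<and>
          (\<forall>a\<in>\<A>. lact a ` domD \<subseteq> domD \<and>
             (\<exists>C. \<forall>\<psi>\<in>domD. mnorm (D (lact a \<psi>) - lact a (D \<psi>)) \<le> C * mnorm \<psi>))"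


section \<open>The algebras \<open>C(S\<^sup>n)\<close> and \<open>C\<^sub>0(\<real>\<^sup>n\<^sup>+\<^sup>1)\<close>\<close>

text \<open>
  A function on \<open>X\<close> is represented by its extension by zero to the ambient type, so that
  pointwise operations restrict to the carriers and equality of functions is equality on \<open>X\<close>;
  the supremum over the whole type is then the supremum over \<open>X\<close>.
\<close>

definition cont_funs :: "'x::topological_space set \<Rightarrow> ('x \<Rightarrow> complex) set" where
  "cont_funs X = {f. continuous_on X f \<and> (\<forall>x. x \<notin> X \<longrightarrow> f x = 0)}"

definition c0_funs :: "'x::topological_space set \<Rightarrow> ('x \<Rightarrow> complex) set" where
  "c0_funs X = {f \<in> cont_funs X. \<forall>e>0. compact {x \<in> X. e \<le> cmod (f x)}}"

definition fun_alg :: "('x \<Rightarrow> complex) set \<Rightarrow> ('x \<Rightarrow> complex) star_alg" where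
  "fun_alg F = \<lparr>alg_carrier = F, alg_scale = (\<lambda>c f x. c * f x), alg_star = (\<lambda>f x. cnj (f x)),
     alg_norm = (\<lambda>f. SUP x. cmod (f x))\<rparr>"

definition C_sphere :: "((real^'d) \<Rightarrow> complex) star_alg" where
  "C_sphere = fun_alg (cont_funs (sphere 0 1))"

definition C0_space :: "((real^'d) \<Rightarrow> complex) star_alg" where
  "C0_space = fun_alg (c0_funs UNIV)"


section \<open>The module and the operator\<close>

definition cyl :: "real \<Rightarrow> ((real^'d) \<times> real) set" where
  "cyl \<epsilon> = sphere 0 1 \<times> {-\<epsilon><..<\<epsilon>}"

text \<open>Spherical coordinates \<open>(\<theta>, r)\<close> stand for the point \<open>r \<theta>\<close>, so \<open>r\<close> is the norm.\<close>

definition emb :: "(real^'d) \<times> real \<Rightarrow> (real^'d)" where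
  "emb = (\<lambda>(\<theta>, s). (s + 1) *\<^sub>R \<theta>)"

definition shell_ip :: "nat \<Rightarrow> real \<Rightarrow> ((real^'d) \<times> real \<Rightarrow> complex) \<Rightarrow> ((real^'d) \<times> real \<Rightarrow> complex)
    \<Rightarrow> (real^'d) \<Rightarrow> complex" where
  "shell_ip n \<epsilon> \<psi> \<phi> x =
     (if x \<in> emb ` cyl \<epsilon>
      then of_real (1 / norm x ^ n) * cnj (\<psi> (inv_into (cyl \<epsilon>) emb x)) * \<phi> (inv_into (cyl \<epsilon>) emb x)
      else 0)"

definition shell_module ::
  "nat \<Rightarrow> real \<Rightarrow> ((real^'d) \<times> real \<Rightarrow> complex, (real^'d) \<Rightarrow> complex) right_module" where
  "shell_module n \<epsilon> = \<lparr>mod_carrier = c0_funs (cyl \<epsilon>), mod_scale = (\<lambda>c \<psi> p. c * \<psi> p),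
     mod_act = (\<lambda>\<psi> h p. \<psi> p * h (emb p)), mod_ip = shell_ip n \<epsilon>\<rparr>"

definition sphere_act ::
  "((real^'d) \<Rightarrow> complex) \<Rightarrow> ((real^'d) \<times> real \<Rightarrow> complex) \<Rightarrow> (real^'d) \<times> real \<Rightarrow> complex" where
  "sphere_act g \<psi> = (\<lambda>(\<theta>, s). g \<theta> * \<psi> (\<theta>, s))"

definition tan_potential :: "real \<Rightarrow> real \<Rightarrow> real" where
  "tan_potential \<epsilon> s = (let \<alpha> = pi / (2 * \<epsilon>) in \<alpha> * tan (\<alpha> * s))"

definition S_op ::
  "real \<Rightarrow> ((real^'d) \<times> real \<Rightarrow> complex) \<Rightarrow> (real^'d) \<times> real \<Rightarrow> complex" where
  "S_op \<epsilon> \<psi> = (\<lambda>(\<theta>, s). of_real (tan_potential \<epsilon> s) * \<psi> (\<theta>, s))"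

definition S_dom :: "real \<Rightarrow> ((real^'d) \<times> real \<Rightarrow> complex) set" where
  "S_dom \<epsilon> = {\<psi> \<in> c0_funs (cyl \<epsilon>). S_op \<epsilon> \<psi> \<in> c0_funs (cyl \<epsilon>)}"

end

theory Submission
  imports Defs
begin

text \<open>
  Everything in sight is multiplication by a function on the cylinder. The potential \<open>f\<close> is proper,
  \<open>\<bar>f\<bar> \<rightarrow> \<infinity>\<close> at both ends of the cylinder, so the functions \<open>1 / (f - z)\<close> with \<open>z\<close> not real vanish at
  infinity; multiplication by them is the resolvent of \<open>S\<close>. Multiplication by a function vanishing
  at infinity is a norm limit of rank one operators, which gives compactness, and the commutators
  with \<open>C(S\<^sup>n)\<close> vanish. The module norm is equivalent to the supremum norm because the radius
  stays in \<open>[1 - \<epsilon>, 1 + \<epsilon>]\<close>.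
\<close>

section \<open>Functions vanishing at infinity\<close>

text \<open>The constant \<open>pi / (2 * \<epsilon>)\<close> puts the poles of the tangent exactly
  at the two ends of the cylinder, which makes f continuous inside and proper. The bound
  \<open>\<epsilon> < 1\<close> keeps the radius positive, so the embedding is injective and its
  image is a shell avoiding the origin. This shell is open, and openness is what lets a function
  vanishing at infinity on it extend continuously by zero. The cylinder is not open in its ambient
  type, so inner products have to be carried to the shell before they can be read as elements of C_0
  of the whole space. Membership in the domain needs no growth estimate: f / (f - z) = 1 + z / (f -
  z) is bounded, so products of 1 / (f - z) with elements of the module lie in the domain. They
  supply the dense approximants, a test function without zeros that determines the adjoint, and the
  solutions of (1 + S^2) psi = phi.\<close>

lemma c0_funsI:
  assumes "continuous_on X f" "\<And>x. x \<notin> X \<Longrightarrow> f x = 0"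
    and "\<And>e. e > 0 \<Longrightarrow> \<exists>K. compact K \<and> K \<subseteq> X \<and> {x \<in> X. e \<le> cmod (f x)} \<subseteq> K"
  shows "f \<in> c0_funs X"
proof -
  have "compact {x \<in> X. e \<le> cmod (f x)}" if e: "e > 0" for e
  proof -
    obtain K where K: "compact K" "K \<subseteq> X" "{x \<in> X. e \<le> cmod (f x)} \<subseteq> K"
      using assms(3)[OF e] by metis
    \<comment> \<open>The superlevel set is closed only relative to X; trapped in a compact K inside
      X it becomes K cut by a closed set, hence compact.\<close>
    have "closedin (top_of_set X) (X \<inter> (\<lambda>x. cmod (f x)) -` {e..})"
      by (intro continuous_closedin_preimage continuous_on_norm assms(1) closed_atLeast)
    then obtain T where T: "closed T" "X \<inter> (\<lambda>x. cmod (f x)) -` {e..} = X \<inter> T"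
      by (auto simp: closedin_closed)
    have "{x \<in> X. e \<le> cmod (f x)} = K \<inter> T"
      using T(2) K by (auto simp: set_eq_iff)
    then show ?thesis using K T by (simp add: compact_Int_closed)
  qed
  then show ?thesis using assms by (auto simp: c0_funs_def cont_funs_def)
qed

lemma c0_funsD:
  assumes "f \<in> c0_funs X"
  shows "continuous_on X f" "x \<notin> X \<Longrightarrow> f x = 0" "e > 0 \<Longrightarrow> compact {x \<in> X. e \<le> cmod (f x)}"
  using assms by (auto simp: c0_funs_def cont_funs_def)

lemma c0_funs_bounded:
  assumes "f \<in> c0_funs X"
  obtains M where "M > 0" "\<And>x. cmod (f x) \<le> M"
proof -
  let ?K = "{x \<in> X. 1 \<le> cmod (f x)}"
  have "compact (f ` ?K)"
    using c0_funsD[OF assms] by (intro compact_continuous_image) (auto intro: continuous_on_subset)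
  then obtain M where M: "M > 0" "\<And>y. y \<in> f ` ?K \<Longrightarrow> cmod y \<le> M"
    using compact_imp_bounded bounded_pos by metis
  have "cmod (f x) \<le> max M 1" for x
  proof (cases "x \<in> X \<and> 1 \<le> cmod (f x)")
    case True
    then show ?thesis using M(2)[of "f x"] by (simp add: le_max_iff_disj)
  next
    case False
    then show ?thesis using c0_funsD(2)[OF assms, of x] by (cases "x \<in> X") auto
  qed
  then show ?thesis using that[of "max M 1"] by simp
qed

lemma c0_funs_bdd_above:
  assumes "f \<in> c0_funs X"
  shows "bdd_above (range (\<lambda>x. cmod (f x)))"
proof -
  obtain M where "\<And>x. cmod (f x) \<le> M" using c0_funs_bounded[OF assms] by blast
  then show ?thesis by (rule bdd_aboveI2)
qed

section \<open>Pointwise operations on C_0(X)\<close>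

lemma c0_funs_mult:
  assumes "f \<in> c0_funs X" "continuous_on X m" "\<And>x. x \<in> X \<Longrightarrow> cmod (m x) \<le> M"
  shows "(\<lambda>x. m x * f x) \<in> c0_funs X"
proof (rule c0_funsI)
  show "continuous_on X (\<lambda>x. m x * f x)"
    using assms c0_funsD by (intro continuous_intros) auto
  show "m x * f x = 0" if "x \<notin> X" for x using c0_funsD(2)[OF assms(1) that] by simp
  fix e :: real assume "e > 0"
  \<comment> \<open>The maximum with 1 makes the divisor in \<open>e / M'\<close> positive even if M
    is 0 or X is empty.\<close>
  define M' where "M' = max M 1"
  have M': "M' > 0" "\<And>x. x \<in> X \<Longrightarrow> cmod (m x) \<le> M'" using assms(3) by (force simp: M'_def)+
  have "e / M' \<le> cmod (f x)" if "x \<in> X" "e \<le> cmod (m x * f x)" for x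
  proof -
    have "e \<le> M' * cmod (f x)"
      using that M' by (metis mult_right_mono norm_ge_zero norm_mult order_trans)
    then show ?thesis using M' by (simp add: divide_le_eq mult.commute)
  qed
  then show "\<exists>K. compact K \<and> K \<subseteq> X \<and> {x \<in> X. e \<le> cmod (m x * f x)} \<subseteq> K"
    using c0_funsD(3)[OF assms(1), of "e / M'"] M' \<open>e > 0\<close>
    by (intro exI[of _ "{x \<in> X. e / M' \<le> cmod (f x)}"]) auto
qed

lemma c0_funs_times:
  assumes "f \<in> c0_funs X" "g \<in> c0_funs X"
  shows "(\<lambda>x. f x * g x) \<in> c0_funs X"
proof -
  obtain M where "\<And>x. cmod (f x) \<le> M" using c0_funs_bounded[OF assms(1)] by blast
  then show ?thesis by (intro c0_funs_mult[OF assms(2) c0_funsD(1)[OF assms(1)]])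
qed

lemma c0_funs_scale: "f \<in> c0_funs X \<Longrightarrow> (\<lambda>x. c * f x) \<in> c0_funs X"
  by (rule c0_funs_mult[where m = "\<lambda>_. c" and M = "cmod c"]) auto

lemma c0_funs_add:
  assumes "f \<in> c0_funs X" "g \<in> c0_funs X"
  shows "(\<lambda>x. f x + g x) \<in> c0_funs X"
proof (rule c0_funsI)
  show "continuous_on X (\<lambda>x. f x + g x)"
    using assms c0_funsD by (intro continuous_intros) auto
  show "f x + g x = 0" if "x \<notin> X" for x
    using c0_funsD(2)[OF assms(1) that] c0_funsD(2)[OF assms(2) that] by simp
  fix e :: real assume e: "e > 0"
  have "e / 2 \<le> cmod (f x) \<or> e / 2 \<le> cmod (g x)" if "e \<le> cmod (f x + g x)" for x
    using norm_triangle_ineq[of "f x" "g x"] that by linarith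
  then show "\<exists>K. compact K \<and> K \<subseteq> X \<and> {x \<in> X. e \<le> cmod (f x + g x)} \<subseteq> K"
    using c0_funsD(3)[OF assms(1), of "e / 2"] c0_funsD(3)[OF assms(2), of "e / 2"] e
    by (intro exI[of _ "{x \<in> X. e / 2 \<le> cmod (f x)} \<union> {x \<in> X. e / 2 \<le> cmod (g x)}"]) auto
qed

lemma c0_funs_diff:
  assumes "f \<in> c0_funs X" "g \<in> c0_funs X"
  shows "(\<lambda>x. f x - g x) \<in> c0_funs X"
  using c0_funs_add[OF assms(1) c0_funs_scale[OF assms(2), of "-1"]] by simp

lemma c0_funs_zero: "(\<lambda>_. 0) \<in> c0_funs X"
  by (rule c0_funsI) auto

lemma c0_funs_cnj: "f \<in> c0_funs X \<Longrightarrow> (\<lambda>x. cnj (f x)) \<in> c0_funs X"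
  by (auto simp: c0_funs_def cont_funs_def intro!: continuous_intros)

text \<open>Lets C(S^n) share the C*-algebra proof written for C_0: a compact X itself traps every
  superlevel set.\<close>

lemma c0_funs_compact: "compact X \<Longrightarrow> c0_funs X = cont_funs X"
proof
  show "c0_funs X \<subseteq> cont_funs X" by (auto simp: c0_funs_def)
  show "cont_funs X \<subseteq> c0_funs X" if "compact X"
  proof
    fix f assume "f \<in> cont_funs X"
    then show "f \<in> c0_funs X"
      using that by (intro c0_funsI) (auto simp: cont_funs_def intro!: exI[of _ X])
  qed
qed

section \<open>Extension by zero and transport along homeomorphisms\<close>

text \<open>Continuity is at stake only outside U. There f is 0, and since compact sets are closed
  in a Hausdorff space, the complement of a superlevel set is a neighbourhood on which f is
  small.\<close>

lemma c0_funs_extend: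
  fixes U :: "'x::t2_space set"
  assumes "open U" "f \<in> c0_funs U"
  shows "f \<in> c0_funs UNIV"
proof (rule c0_funsI)
  have K: "{x. e \<le> cmod (f x)} = {x \<in> U. e \<le> cmod (f x)}" if "e > 0" for e
    using c0_funsD(2)[OF assms(2)] that by force
  have "isCont f x" for x
  proof (cases "x \<in> U")
    case True
    then show ?thesis
      using c0_funsD(1)[OF assms(2)] assms(1) continuous_on_eq_continuous_at by blast
  next
    case False
    have "\<forall>\<^sub>F y in at x. cmod (f y) < e" if "e > 0" for e
    proof -
      have "open (- {x. e \<le> cmod (f x)})"
        using c0_funsD(3)[OF assms(2) that] K[OF that] by (simp add: compact_imp_closed open_Compl)
      moreover have "x \<in> - {x. e \<le> cmod (f x)}"
        using False c0_funsD(2)[OF assms(2)] that by simp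
      ultimately have "\<forall>\<^sub>F y in nhds x. y \<in> - {x. e \<le> cmod (f x)}"
        by (rule eventually_nhds_in_open)
      then have "\<forall>\<^sub>F y in at x. y \<in> - {x. e \<le> cmod (f x)}"
        by (simp add: eventually_at_filter eventually_mono)
      then show ?thesis by eventually_elim simp
    qed
    then show ?thesis
      using c0_funsD(2)[OF assms(2) False] by (simp add: isCont_def tendsto_iff)
  qed
  then show "continuous_on UNIV f" by (simp add: continuous_on_eq_continuous_at)
  show "\<exists>K. compact K \<and> K \<subseteq> UNIV \<and> {x \<in> UNIV. e \<le> cmod (f x)} \<subseteq> K" if "e > 0" for e
    using c0_funsD(3)[OF assms(2) that] K[OF that] by auto
qed auto

text \<open>Superlevel sets of the transported function lie in h-images of superlevel sets. The case
  distinction restores the zero extension, because the values of g outside U are arbitrary.\<close>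

lemma c0_funs_transport:
  assumes "homeomorphism X U h g" "f \<in> c0_funs X"
  shows "(\<lambda>y. if y \<in> U then f (g y) else 0) \<in> c0_funs U"
proof (rule c0_funsI)
  note h = assms(1)[unfolded homeomorphism_def]
  have "continuous_on U (f \<circ> g)"
    using h c0_funsD(1)[OF assms(2)] by (intro continuous_on_compose) auto
  then show "continuous_on U (\<lambda>y. if y \<in> U then f (g y) else 0)"
    by (rule continuous_on_eq) auto
  fix e :: real assume e: "e > 0"
  have "compact (h ` {x \<in> X. e \<le> cmod (f x)})"
    using h c0_funsD(3)[OF assms(2) e]
    by (intro compact_continuous_image) (auto intro: continuous_on_subset)
  moreover have "{y \<in> U. e \<le> cmod (if y \<in> U then f (g y) else 0)} \<subseteq> h ` {x \<in> X. e \<le> cmod (f x)}"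
  proof
    fix y assume y: "y \<in> {y \<in> U. e \<le> cmod (if y \<in> U then f (g y) else 0)}"
    then have "y = h (g y)" "g y \<in> X" using h by auto
    then show "y \<in> h ` {x \<in> X. e \<le> cmod (f x)}" using y by (intro image_eqI[of _ _ "g y"]) auto
  qed
  ultimately show "\<exists>K. compact K \<and> K \<subseteq> U \<and>
      {y \<in> U. e \<le> cmod (if y \<in> U then f (g y) else 0)} \<subseteq> K"
    using h by (intro exI[of _ "h ` {x \<in> X. e \<le> cmod (f x)}"]) auto
qed auto

section \<open>Completeness and the C*-algebra structure of C_0(X)\<close>

lemma c0_funs_complete: "complete_wrt (\<lambda>f. SUP x. cmod (f x)) (c0_funs X)"
  unfolding complete_wrt_def
proof (intro allI impI, elim conjE)
  fix F :: "nat \<Rightarrow> 'a \<Rightarrow> complex"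
  assume F: "\<forall>k. F k \<in> c0_funs X"
    and Cauchy: "\<forall>e>0. \<exists>N. \<forall>m\<ge>N. \<forall>k\<ge>N. (SUP x. cmod ((F m - F k) x)) < e"
  \<comment> \<open>A real supremum dominates the values only of a family bounded above, so this has
    to precede the passage from norms to pointwise bounds.\<close>
  have bdd: "bdd_above (range (\<lambda>x. cmod ((F m - F k) x)))" for m k
  proof -
    have "(\<lambda>x. F m x + (-1) * F k x) \<in> c0_funs X"
      using F by (intro c0_funs_add c0_funs_scale) auto
    then show ?thesis using c0_funs_bdd_above by (fastforce simp: fun_diff_def)
  qed
  have Cauchy_ptw: "\<exists>N. \<forall>m\<ge>N. \<forall>k\<ge>N. \<forall>x. cmod (F m x - F k x) < e" if e: "e > 0" for e
  proof -
    obtain N where N: "\<forall>m\<ge>N. \<forall>k\<ge>N. (SUP x. cmod ((F m - F k) x)) < e"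
      using Cauchy e by blast
    have "cmod (F m x - F k x) < e" if "m \<ge> N" "k \<ge> N" for m k x
      using N that cSUP_upper[of x UNIV, OF UNIV_I bdd[of m k]] by (fastforce simp: fun_diff_def)
    then show ?thesis by blast
  qed
  then have "uniformly_Cauchy_on UNIV F"
    unfolding uniformly_Cauchy_on_def by (simp add: dist_norm) meson
  then obtain l where l: "uniform_limit UNIV F l sequentially"
    using uniformly_convergent_on_def Cauchy_uniformly_convergent by blast
  have close: "\<exists>N. \<forall>k\<ge>N. \<forall>x. cmod (F k x - l x) < e" if "e > 0" for e
    using l that by (auto simp: uniform_limit_iff eventually_sequentially dist_norm)
  have "l \<in> c0_funs X"
  proof (rule c0_funsI)
    show "continuous_on X l"
    proof (rule uniform_limit_theorem)
      show "\<forall>\<^sub>F k in sequentially. continuous_on X (F k)"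
        using F by (intro always_eventually allI c0_funsD(1)) simp
      show "uniform_limit X F l sequentially" using l by (rule uniform_limit_on_subset) auto
    qed auto
    show "l x = 0" if "x \<notin> X" for x
    proof -
      have "(\<lambda>k. F k x) \<longlonglongrightarrow> l x" using l by (auto intro: tendsto_uniform_limitI)
      moreover have "(\<lambda>k. F k x) = (\<lambda>_. 0)" using F c0_funsD(2) that by fastforce
      ultimately show ?thesis by (simp add: LIMSEQ_const_iff)
    qed
    fix e :: real assume e: "e > 0"
    \<comment> \<open>An approximation within e / 2 puts the superlevel set of the limit at e inside
      that of \<open>F k\<close> at e / 2.\<close>
    obtain k where k: "\<And>x. cmod (F k x - l x) < e / 2" using close[of "e / 2"] e by auto
    have "e / 2 \<le> cmod (F k x)" if "e \<le> cmod (l x)" for x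
      using k[of x] that norm_triangle_ineq2[of "l x" "F k x"] by (simp add: norm_minus_commute)
    then show "\<exists>K. compact K \<and> K \<subseteq> X \<and> {x \<in> X. e \<le> cmod (l x)} \<subseteq> K"
      using c0_funsD(3)[of "F k" X "e / 2"] F e
      by (intro exI[of _ "{x \<in> X. e / 2 \<le> cmod (F k x)}"]) auto
  qed
  moreover have "(\<lambda>k. SUP x. cmod ((F k - l) x)) \<longlonglongrightarrow> 0"
  proof (rule LIMSEQ_I)
    fix e :: real assume e: "e > 0"
    obtain N where N: "\<And>k x. k \<ge> N \<Longrightarrow> cmod (F k x - l x) < e / 2"
      using close[of "e / 2"] e by auto
    have "norm ((SUP x. cmod ((F k - l) x)) - 0) < e" if "k \<ge> N" for k
    proof -
      have le: "cmod ((F k - l) x) \<le> e / 2" for x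
        using N[OF that, of x] by (simp add: fun_diff_def less_imp_le)
      have "(SUP x. cmod ((F k - l) x)) \<le> e / 2" using le by (intro cSUP_least) auto
      moreover have "0 \<le> (SUP x. cmod ((F k - l) x))"
        using bdd_aboveI2[OF le] by (intro cSUP_upper2[of _ _ undefined]) auto
      ultimately show ?thesis using e by simp
    qed
    then show "\<exists>N. \<forall>k\<ge>N. norm ((SUP x. cmod ((F k - l) x)) - 0) < e" by blast
  qed
  ultimately show "\<exists>l\<in>c0_funs X. (\<lambda>k. SUP x. cmod ((F k - l) x)) \<longlonglongrightarrow> 0" by blast
qed

lemma vector_space_pointwise: "vector_space (\<lambda>c (f :: 'x \<Rightarrow> complex) x. c * f x)"
  by unfold_locales (rule ext, simp add: algebra_simps)+

lemma subspace_c0_funs: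
  "module.subspace (\<lambda>c (f :: 'x::topological_space \<Rightarrow> complex) x. c * f x) (c0_funs X)"
proof -
  interpret vector_space "\<lambda>c (f :: 'x \<Rightarrow> complex) x. c * f x" by (rule vector_space_pointwise)
  show ?thesis
    by (intro subspaceI)
      (simp_all add: zero_fun_def plus_fun_def c0_funs_zero c0_funs_add c0_funs_scale)
qed

lemma cstar_algebra_c0_funs: "cstar_algebra (fun_alg (c0_funs X))"
proof -
  interpret vector_space "\<lambda>c (f :: 'a \<Rightarrow> complex) x. c * f x" by (rule vector_space_pointwise)
  have upper: "cmod (f x) \<le> (SUP x. cmod (f x))" if "f \<in> c0_funs X" for f x
    using that by (intro cSUP_upper c0_funs_bdd_above) auto
  have nonneg: "0 \<le> (SUP x. cmod (f x))" if "f \<in> c0_funs X" for f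
    using upper[OF that, of undefined] norm_ge_zero order_trans by blast
  have prod_upper: "cmod (f x) * cmod (g x) \<le> (SUP x. cmod (f x)) * (SUP x. cmod (g x))"
    if "f \<in> c0_funs X" "g \<in> c0_funs X" for f g x
    using that by (intro mult_mono upper nonneg) auto
  show ?thesis
  proof (unfold_locales, unfold fun_alg_def star_alg.simps)
    show "subspace (c0_funs X)" by (rule subspace_c0_funs)
    show "complete_wrt (\<lambda>f. SUP x. cmod (f x)) (c0_funs X)" by (rule c0_funs_complete)
    fix f g :: "'a \<Rightarrow> complex" and c :: complex
    assume f: "f \<in> c0_funs X"
    show "(\<lambda>x. cnj (f x)) \<in> c0_funs X" using f by (rule c0_funs_cnj)
    show "(\<lambda>x. cnj (cnj (f x))) = f" by simp
    show "(\<lambda>x. cnj (c * f x)) = (\<lambda>x. cnj c * cnj (f x))" by simp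
    show "0 \<le> (SUP x. cmod (f x))" using f by (rule nonneg)
    show "((SUP x. cmod (f x)) = 0) = (f = 0)"
    proof
      assume "(SUP x. cmod (f x)) = 0"
      then have "cmod (f x) \<le> 0" for x using upper[OF f, of x] by simp
      then show "f = 0" by (intro ext) simp
    qed simp
    show "(SUP x. cmod (c * f x)) = cmod c * (SUP x. cmod (f x))"
    proof -
      have "(SUP x. cmod c * cmod (f x)) = cmod c * (SUP x. cmod (f x))"
      proof (rule antisym)
        show "(SUP x. cmod c * cmod (f x)) \<le> cmod c * (SUP x. cmod (f x))"
          by (intro cSUP_least mult_left_mono upper f) auto
        show "cmod c * (SUP x. cmod (f x)) \<le> (SUP x. cmod c * cmod (f x))"
        proof (cases "c = 0")
          case False
          have "cmod c * cmod (f x) \<le> (SUP x. cmod c * cmod (f x))" for x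
            using c0_funs_bdd_above[OF c0_funs_scale[OF f, of c]]
            by (intro cSUP_upper) (auto simp: norm_mult)
          then have "(SUP x. cmod (f x)) \<le> (SUP x. cmod c * cmod (f x)) / cmod c"
            using False by (intro cSUP_least) (auto simp: field_simps)
          then show ?thesis using False by (simp add: field_simps)
        qed auto
      qed
      then show ?thesis by (simp add: norm_mult)
    qed
    show "(SUP x. cmod (((\<lambda>x. cnj (f x)) * f) x)) = (SUP x. cmod (f x))\<^sup>2"
    proof (rule antisym)
      show "(SUP x. cmod (((\<lambda>x. cnj (f x)) * f) x)) \<le> (SUP x. cmod (f x))\<^sup>2"
        using prod_upper[OF f f] by (intro cSUP_least) (auto simp: norm_mult power2_eq_square)
      let ?g = "\<lambda>x. cmod (((\<lambda>x. cnj (f x)) * f) x)"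
      have "(cmod (f x))\<^sup>2 \<le> Sup (range ?g)" for x
        using c0_funs_bdd_above[OF c0_funs_times[OF c0_funs_cnj[OF f] f]]
        by (intro cSUP_upper2[of _ _ x]) (auto simp: norm_mult power2_eq_square times_fun_def)
      \<comment> \<open>Passing to square roots lets the supremum be taken of
        \<open>cmod (f x)\<close> itself, so squaring is never interchanged with a supremum.\<close>
      then have "cmod (f x) \<le> sqrt (Sup (range ?g))" for x by (simp add: real_le_rsqrt)
      then have "(SUP x. cmod (f x)) \<le> sqrt (Sup (range ?g))" by (intro cSUP_least) auto
      then have "(SUP x. cmod (f x))\<^sup>2 \<le> (sqrt (Sup (range ?g)))\<^sup>2"
        using nonneg[OF f] by (rule power_mono)
      also have "\<dots> = Sup (range ?g)"
        using \<open>\<And>x. (cmod (f x))\<^sup>2 \<le> Sup (range ?g)\<close>[of undefined]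
        by (intro real_sqrt_pow2) (metis order_trans zero_le_power2)
      finally show "(SUP x. cmod (f x))\<^sup>2 \<le> Sup (range ?g)" .
    qed
    assume g: "g \<in> c0_funs X"
    show "f * g \<in> c0_funs X" using c0_funs_times[OF f g] by (simp add: times_fun_def)
    show "(\<lambda>x. c * f x) * g = (\<lambda>x. c * (f * g) x)" by (rule ext) (simp add: algebra_simps)
    show "f * (\<lambda>x. c * g x) = (\<lambda>x. c * (f * g) x)" by (rule ext) (simp add: algebra_simps)
    show "(\<lambda>x. cnj ((f + g) x)) = (\<lambda>x. cnj (f x)) + (\<lambda>x. cnj (g x))" by (rule ext) (simp add: algebra_simps)
    show "(\<lambda>x. cnj ((f * g) x)) = (\<lambda>x. cnj (g x)) * (\<lambda>x. cnj (f x))" by (rule ext) (simp add: algebra_simps)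
    show "(SUP x. cmod ((f + g) x)) \<le> (SUP x. cmod (f x)) + (SUP x. cmod (g x))"
      using upper[OF f] upper[OF g]
      by (intro cSUP_least) (auto intro: norm_triangle_le add_mono)
    show "(SUP x. cmod ((f * g) x)) \<le> (SUP x. cmod (f x)) * (SUP x. cmod (g x))"
      using prod_upper[OF f g] by (intro cSUP_least) (auto simp: norm_mult)
  qed (rule ext, simp add: algebra_simps)+
qed

text \<open>Carries completeness from the supremum norm to the module norm: the bound on p turns
  q-Cauchy sequences into p-Cauchy ones, the bound on q turns the p-limit into a q-limit.\<close>

lemma complete_wrt_equivalent:
  assumes "complete_wrt p V" "\<And>v w. v \<in> V \<Longrightarrow> w \<in> V \<Longrightarrow> v - w \<in> V"
    and pq: "\<And>v. v \<in> V \<Longrightarrow> p v \<le> C * q v" and qp: "\<And>v. v \<in> V \<Longrightarrow> q v \<le> D * p v"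
    and nonneg: "\<And>v. v \<in> V \<Longrightarrow> 0 \<le> q v" and "C > 0"
  shows "complete_wrt q V"
  unfolding complete_wrt_def
proof (intro allI impI, elim conjE)
  fix X :: "nat \<Rightarrow> 'a"
  assume X: "\<forall>k. X k \<in> V" and Cauchy: "\<forall>e>0. \<exists>N. \<forall>m\<ge>N. \<forall>k\<ge>N. q (X m - X k) < e"
  have "\<exists>N. \<forall>m\<ge>N. \<forall>k\<ge>N. p (X m - X k) < e" if e: "e > 0" for e
  proof -
    obtain N where N: "\<forall>m\<ge>N. \<forall>k\<ge>N. q (X m - X k) < e / C"
      using Cauchy e \<open>C > 0\<close> by (meson divide_pos_pos)
    have "p (X m - X k) < e" if mk: "m \<ge> N" "k \<ge> N" for m k
    proof -
      have "p (X m - X k) \<le> C * q (X m - X k)" using X assms(2) by (intro pq) auto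
      also have "\<dots> < e" using N mk \<open>C > 0\<close> by (simp add: pos_less_divide_eq mult.commute)
      finally show ?thesis .
    qed
    then show ?thesis by blast
  qed
  then obtain l where l: "l \<in> V" "(\<lambda>k. p (X k - l)) \<longlonglongrightarrow> 0"
    using assms(1)[unfolded complete_wrt_def, rule_format, of X] X by blast
  have "(\<lambda>k. q (X k - l)) \<longlonglongrightarrow> 0"
  proof (rule tendsto_sandwich)
    show "\<forall>\<^sub>F k in sequentially. 0 \<le> q (X k - l)"
      using X l assms(2) by (intro always_eventually allI nonneg) auto
    show "\<forall>\<^sub>F k in sequentially. q (X k - l) \<le> D * p (X k - l)"
      using X l assms(2) by (intro always_eventually allI qp) auto
    show "(\<lambda>k. D * p (X k - l)) \<longlonglongrightarrow> 0" using tendsto_mult_right_zero[OF l(2)] by simp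
  qed simp
  then show "\<exists>l\<in>V. (\<lambda>k. q (X k - l)) \<longlonglongrightarrow> 0" using l by blast
qed


section \<open>The module of the spherical shell\<close>

text \<open>Every inner product is such a push-forward (\<open>shell_ip_push\<close>), so vanishing
  at infinity on the whole space is proved once, in \<open>push_c0_funs\<close>.\<close>

definition push :: "real \<Rightarrow> ((real^'d) \<times> real \<Rightarrow> complex) \<Rightarrow> real^'d \<Rightarrow> complex" where
  "push \<epsilon> \<psi> x = (if x \<in> emb ` cyl \<epsilon> then \<psi> (inv_into (cyl \<epsilon>) emb x) else 0)"

text \<open>This is \<open>mnorm\<close>, stated outside the Hilbert module locale because
  completeness in this norm is among the axioms needed to enter it.\<close>

definition shell_norm :: "nat \<Rightarrow> real \<Rightarrow> ((real^'d) \<times> real \<Rightarrow> complex) \<Rightarrow> real" where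
  "shell_norm n \<epsilon> \<psi> = sqrt (SUP x. cmod (shell_ip n \<epsilon> \<psi> \<psi> x))"

lemma norm_emb: "\<epsilon> < 1 \<Longrightarrow> p \<in> cyl \<epsilon> \<Longrightarrow> norm (emb p) = snd p + 1"
  by (auto simp: cyl_def emb_def)

text \<open>The inverse is given by polar coordinates, continuous because
  \<open>\<epsilon> < 1\<close> keeps the origin out of the shell. Describing the image by norm
  inequalities makes its openness evident.\<close>

lemma homeomorphism_emb:
  assumes "\<epsilon> < 1"
  shows "homeomorphism (cyl \<epsilon>) {x :: real^'d. 1 - \<epsilon> < norm x \<and> norm x < 1 + \<epsilon>} emb
    (\<lambda>x. (x /\<^sub>R norm x, norm x - 1))"
proof (rule homeomorphismI)
  show "continuous_on (cyl \<epsilon>) (emb :: (real^'d) \<times> real \<Rightarrow> _)"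
    unfolding emb_def case_prod_unfold by (intro continuous_intros)
  show "continuous_on {x. 1 - \<epsilon> < norm x \<and> norm x < 1 + \<epsilon>}
      (\<lambda>x :: real^'d. (x /\<^sub>R norm x, norm x - 1))"
    using assms by (intro continuous_intros) auto
next
  fix x :: "real^'d" assume "x \<in> {x. 1 - \<epsilon> < norm x \<and> norm x < 1 + \<epsilon>}"
  then have "x \<noteq> 0" using assms by auto
  then show "emb (x /\<^sub>R norm x, norm x - 1) = x" by (simp add: emb_def)
next
  fix p :: "(real^'d) \<times> real" assume p: "p \<in> cyl \<epsilon>"
  then have "snd p + 1 \<noteq> 0" using assms by (auto simp: cyl_def)
  then show "(emb p /\<^sub>R norm (emb p), norm (emb p) - 1) = p"
    using norm_emb[OF assms p] by (simp add: emb_def case_prod_unfold)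
next
  show "emb ` cyl \<epsilon> \<subseteq> {x :: real^'d. 1 - \<epsilon> < norm x \<and> norm x < 1 + \<epsilon>}"
    using assms by (auto simp: norm_emb) (auto simp: cyl_def)
  show "(\<lambda>x :: real^'d. (x /\<^sub>R norm x, norm x - 1)) ` {x. 1 - \<epsilon> < norm x \<and> norm x < 1 + \<epsilon>}
      \<subseteq> cyl \<epsilon>"
  proof (rule image_subsetI)
    fix x :: "real^'d" assume x: "x \<in> {x. 1 - \<epsilon> < norm x \<and> norm x < 1 + \<epsilon>}"
    then have "x \<noteq> 0" using assms by auto
    then show "(x /\<^sub>R norm x, norm x - 1) \<in> cyl \<epsilon>" using x by (simp add: cyl_def)
  qed
qed

lemma inj_on_emb:
  assumes "\<epsilon> < 1"
  shows "inj_on (emb :: (real^'d) \<times> real \<Rightarrow> _) (cyl \<epsilon>)"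
proof -
  obtain g where "homeomorphism (cyl \<epsilon>) {x :: real^'d. 1 - \<epsilon> < norm x \<and> norm x < 1 + \<epsilon>} emb g"
    using homeomorphism_emb[OF assms] by blast
  then show ?thesis by (intro inj_on_inverseI[of _ g]) (rule homeomorphism_apply1)
qed

lemma push_emb: "\<epsilon> < 1 \<Longrightarrow> p \<in> cyl \<epsilon> \<Longrightarrow> push \<epsilon> \<psi> (emb p) = \<psi> p"
  by (simp add: push_def inv_into_f_f inj_on_emb)

lemma push_c0_funs:
  fixes \<psi> :: "(real^'d) \<times> real \<Rightarrow> complex"
  assumes "\<epsilon> < 1" "\<psi> \<in> c0_funs (cyl \<epsilon>)"
  shows "push \<epsilon> \<psi> \<in> c0_funs UNIV"
proof -
  let ?U = "{x :: real^'d. 1 - \<epsilon> < norm x \<and> norm x < 1 + \<epsilon>}"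
  let ?g = "\<lambda>x :: real^'d. (x /\<^sub>R norm x, norm x - 1)"
  have h: "homeomorphism (cyl \<epsilon>) ?U emb ?g" using assms(1) by (rule homeomorphism_emb)
  have U: "emb ` cyl \<epsilon> = ?U" using h unfolding homeomorphism_def by blast
  have "push \<epsilon> \<psi> x = (if x \<in> ?U then \<psi> (?g x) else 0)" for x
  proof (cases "x \<in> ?U")
    case True
    then obtain p where p: "p \<in> cyl \<epsilon>" "x = emb p" using U by blast
    moreover have "?g (emb p) = p" using h p(1) unfolding homeomorphism_def by blast
    ultimately show ?thesis using True push_emb[OF assms(1) p(1)] by simp
  next
    case False
    then have "x \<notin> emb ` cyl \<epsilon>" using U by simp
    then show ?thesis unfolding push_def if_not_P[OF False] by (rule if_not_P)
  qed
  moreover have "open ?U"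
    by (intro open_Collect_conj open_Collect_less continuous_intros)
  ultimately show ?thesis
    using c0_funs_extend[OF _ c0_funs_transport[OF h assms(2)]] by presburger
qed

section \<open>The weighted inner product and the module norm\<close>

lemma shell_ip_emb:
  assumes "\<epsilon> < 1" "p \<in> cyl \<epsilon>"
  shows "shell_ip n \<epsilon> \<psi> \<phi> (emb p) = of_real (1 / (snd p + 1) ^ n) * cnj (\<psi> p) * \<phi> p"
proof -
  show ?thesis using assms by (simp add: shell_ip_def inv_into_f_f inj_on_emb norm_emb)
qed

lemma shell_ip_outside: "x \<notin> emb ` cyl \<epsilon> \<Longrightarrow> shell_ip n \<epsilon> \<psi> \<phi> x = 0"
  by (simp add: shell_ip_def)

lemma shell_ip_push:
  assumes "\<epsilon> < 1"
  shows "shell_ip n \<epsilon> \<psi> \<phi> = push \<epsilon> (\<lambda>p. of_real (1 / (snd p + 1) ^ n) * cnj (\<psi> p) * \<phi> p)"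
proof
  fix x
  show "shell_ip n \<epsilon> \<psi> \<phi> x = push \<epsilon> (\<lambda>p. of_real (1 / (snd p + 1) ^ n) * cnj (\<psi> p) * \<phi> p) x"
  proof (cases "x \<in> emb ` cyl \<epsilon>")
    case True
    then obtain p where "p \<in> cyl \<epsilon>" "x = emb p" by blast
    then show ?thesis by (simp add: shell_ip_emb[OF assms] push_emb[OF assms])
  qed (simp add: shell_ip_def push_def)
qed

text \<open>The radius stays in a compact interval, on which w is bounded. The uses are w = r^(-n)
  for the inner product, r^(-n/2) for its square root and r^n for undoing the weight.\<close>

lemma weighted_c0_funs:
  fixes \<psi> :: "(real^'d) \<times> real \<Rightarrow> complex" and w :: "real \<Rightarrow> real"
  assumes "\<epsilon> < 1" "\<psi> \<in> c0_funs (cyl \<epsilon>)" "continuous_on {1 - \<epsilon>..1 + \<epsilon>} w"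
  shows "(\<lambda>p. of_real (w (snd p + 1)) * \<psi> p) \<in> c0_funs (cyl \<epsilon>)"
proof -
  have "compact (w ` {1 - \<epsilon>..1 + \<epsilon>})"
    using assms(3) by (intro compact_continuous_image) auto
  then obtain M where M: "\<And>y. y \<in> w ` {1 - \<epsilon>..1 + \<epsilon>} \<Longrightarrow> \<bar>y\<bar> \<le> M"
    using compact_imp_bounded bounded_pos by (metis real_norm_def)
  have "continuous_on (cyl \<epsilon>) (\<lambda>p :: (real^'d) \<times> real. w (snd p + 1))"
    by (rule continuous_on_compose2[OF assms(3)]) (auto simp: cyl_def intro!: continuous_intros)
  then have "continuous_on (cyl \<epsilon>) (\<lambda>p :: (real^'d) \<times> real. complex_of_real (w (snd p + 1)))"
    by (rule continuous_on_of_real)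
  then show ?thesis
    by (rule c0_funs_mult[OF assms(2), where M = M]) (auto simp: cyl_def intro!: M)
qed

lemma shell_ip_c0_funs:
  fixes \<psi> \<phi> :: "(real^'d) \<times> real \<Rightarrow> complex"
  assumes "\<epsilon> < 1" "\<psi> \<in> c0_funs (cyl \<epsilon>)" "\<phi> \<in> c0_funs (cyl \<epsilon>)"
  shows "shell_ip n \<epsilon> \<psi> \<phi> \<in> c0_funs UNIV"
proof -
  have "(\<lambda>p. of_real (1 / (snd p + 1) ^ n) * (cnj (\<psi> p) * \<phi> p)) \<in> c0_funs (cyl \<epsilon>)"
    by (rule weighted_c0_funs[where w = "\<lambda>r. 1 / r ^ n"])
      (use assms in \<open>auto intro!: c0_funs_times c0_funs_cnj continuous_intros\<close>)
  then show ?thesis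
    unfolding shell_ip_push[OF assms(1)] mult.assoc by (rule push_c0_funs[OF assms(1)])
qed

text \<open>At \<open>emb p\<close> the inner product of \<open>\<psi>\<close> with itself has
  modulus |psi p|^2 / r^n. Together with \<open>shell_norm_le\<close> this makes the shell norm the
  least nonnegative M with |psi| <= M r^(n/2) on the cylinder.\<close>

lemma shell_norm_pointwise:
  assumes "\<epsilon> < 1" "\<psi> \<in> c0_funs (cyl \<epsilon>)" "p \<in> cyl \<epsilon>"
  shows "cmod (\<psi> p) \<le> shell_norm n \<epsilon> \<psi> * sqrt ((snd p + 1) ^ n)"
proof -
  have r: "snd p + 1 > 0" using assms by (auto simp: cyl_def)
  have "cmod (shell_ip n \<epsilon> \<psi> \<psi> (emb p)) \<le> (SUP x. cmod (shell_ip n \<epsilon> \<psi> \<psi> x))"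
    using assms by (intro cSUP_upper c0_funs_bdd_above[OF shell_ip_c0_funs]) auto
  then have "(cmod (\<psi> p))\<^sup>2 \<le> (SUP x. cmod (shell_ip n \<epsilon> \<psi> \<psi> x)) * (snd p + 1) ^ n"
    using r assms by (simp add: shell_ip_emb norm_mult norm_divide norm_power
        power2_eq_square pos_divide_le_eq)
  then show ?thesis
    by (simp add: shell_norm_def real_le_rsqrt flip: real_sqrt_mult)
qed

lemma shell_norm_le:
  assumes "\<epsilon> < 1" "M \<ge> 0" "\<And>p. p \<in> cyl \<epsilon> \<Longrightarrow> cmod (\<psi> p) \<le> M * sqrt ((snd p + 1) ^ n)"
  shows "shell_norm n \<epsilon> \<psi> \<le> M"
proof -
  have "cmod (shell_ip n \<epsilon> \<psi> \<psi> x) \<le> M\<^sup>2" for x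
  proof (cases "x \<in> emb ` cyl \<epsilon>")
    case True
    then obtain p where p: "p \<in> cyl \<epsilon>" "x = emb p" by blast
    have r: "snd p + 1 > 0" using assms(1) p by (auto simp: cyl_def)
    have "(cmod (\<psi> p))\<^sup>2 \<le> (M * sqrt ((snd p + 1) ^ n))\<^sup>2"
      using assms(3)[OF p(1)] by (intro power_mono) auto
    also have "\<dots> = M\<^sup>2 * (snd p + 1) ^ n" using r by (simp add: power_mult_distrib)
    finally show ?thesis
      using r p assms by (simp add: shell_ip_emb norm_mult norm_divide norm_power
          power2_eq_square pos_divide_le_eq)
  qed (simp add: shell_ip_outside)
  then have "(SUP x. cmod (shell_ip n \<epsilon> \<psi> \<psi> x)) \<le> M\<^sup>2" by (intro cSUP_least) auto
  then show ?thesis unfolding shell_norm_def using assms(2) by (simp add: real_le_lsqrt)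
qed

lemma shell_norm_le_bound:
  assumes "\<epsilon> < 1" "\<And>p. p \<in> cyl \<epsilon> \<Longrightarrow> cmod (\<psi> p) \<le> M" "M \<ge> 0"
  shows "shell_norm n \<epsilon> \<psi> \<le> M / sqrt ((1 - \<epsilon>) ^ n)"
proof (rule shell_norm_le[OF assms(1)])
  have pos: "sqrt ((1 - \<epsilon>) ^ n) > 0" using assms(1) by simp
  then show "0 \<le> M / sqrt ((1 - \<epsilon>) ^ n)" using assms(3) by simp
  fix p :: "(real^'a) \<times> real" assume p: "p \<in> cyl \<epsilon>"
  have "sqrt ((1 - \<epsilon>) ^ n) \<le> sqrt ((snd p + 1) ^ n)"
    using assms(1) p by (intro real_sqrt_le_mono power_mono) (auto simp: cyl_def)
  then have "M * sqrt ((1 - \<epsilon>) ^ n) \<le> M * sqrt ((snd p + 1) ^ n)"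
    using assms(3) by (rule mult_left_mono)
  then have "M \<le> M / sqrt ((1 - \<epsilon>) ^ n) * sqrt ((snd p + 1) ^ n)"
    using pos by (simp add: field_simps)
  then show "cmod (\<psi> p) \<le> M / sqrt ((1 - \<epsilon>) ^ n) * sqrt ((snd p + 1) ^ n)"
    using assms(2)[OF p] by linarith
qed

lemma shell_norm_nonneg:
  assumes "\<epsilon> < 1" "\<psi> \<in> c0_funs (cyl \<epsilon>)"
  shows "0 \<le> shell_norm n \<epsilon> \<psi>"
proof -
  have "0 \<le> (SUP x. cmod (shell_ip n \<epsilon> \<psi> \<psi> x))"
    using assms by (intro cSUP_upper2[of _ _ undefined] c0_funs_bdd_above[OF shell_ip_c0_funs]) auto
  then show ?thesis by (simp add: shell_norm_def)
qed

lemma shell_norm_complete: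
  assumes "0 < \<epsilon>" "\<epsilon> < 1"
  shows "complete_wrt (shell_norm n \<epsilon>) (c0_funs (cyl \<epsilon>) :: ((real^'d) \<times> real \<Rightarrow> complex) set)"
proof (rule complete_wrt_equivalent[OF c0_funs_complete])
  fix \<psi> :: "(real^'d) \<times> real \<Rightarrow> complex"
  assume \<psi>: "\<psi> \<in> c0_funs (cyl \<epsilon>)"
  show nonneg: "0 \<le> shell_norm n \<epsilon> \<psi>" by (rule shell_norm_nonneg[OF assms(2) \<psi>])
  \<comment> \<open>The 2 bounds the radius, as s < \<epsilon> < 1; the opposite estimate uses that
    the radius exceeds 1 - \<epsilon>.\<close>
  have "cmod (\<psi> p) \<le> sqrt (2 ^ n) * shell_norm n \<epsilon> \<psi>" for p
  proof (cases "p \<in> cyl \<epsilon>")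
    case True
    have "sqrt ((snd p + 1) ^ n) \<le> sqrt (2 ^ n)"
      using assms True by (intro real_sqrt_le_mono power_mono) (auto simp: cyl_def)
    then have "shell_norm n \<epsilon> \<psi> * sqrt ((snd p + 1) ^ n) \<le> shell_norm n \<epsilon> \<psi> * sqrt (2 ^ n)"
      using nonneg by (rule mult_left_mono)
    then show ?thesis
      using shell_norm_pointwise[OF assms(2) \<psi> True, of n] by (simp add: mult.commute)
  next
    case False
    then show ?thesis using c0_funsD(2)[OF \<psi>] nonneg by simp
  qed
  then show "(SUP p. cmod (\<psi> p)) \<le> sqrt (2 ^ n) * shell_norm n \<epsilon> \<psi>"
    by (intro cSUP_least) auto
  have upper: "cmod (\<psi> p) \<le> (SUP p. cmod (\<psi> p))" for p
    using \<psi> by (intro cSUP_upper c0_funs_bdd_above) auto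
  then have "shell_norm n \<epsilon> \<psi> \<le> (SUP p. cmod (\<psi> p)) / sqrt ((1 - \<epsilon>) ^ n)"
    using norm_ge_zero order_trans by (intro shell_norm_le_bound assms) blast+
  then show "shell_norm n \<epsilon> \<psi> \<le> (1 / sqrt ((1 - \<epsilon>) ^ n)) * (SUP p. cmod (\<psi> p))" by simp
qed (auto simp: fun_diff_def c0_funs_diff)

section \<open>The coefficient algebras and the Hilbert module axioms\<close>

lemma cstar_algebra_C_sphere: "cstar_algebra (C_sphere :: ((real^'d) \<Rightarrow> complex) star_alg)"
  unfolding C_sphere_def using cstar_algebra_c0_funs[of "sphere (0 :: real^'d) 1"]
  by (simp add: c0_funs_compact)

lemma cstar_algebra_C0_space: "cstar_algebra C0_space"
  unfolding C0_space_def by (rule cstar_algebra_c0_funs)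

lemma C0_space_simps:
  "alg_carrier C0_space = c0_funs UNIV" "alg_scale C0_space = (\<lambda>c f x. c * f x)"
  "alg_star C0_space = (\<lambda>f x. cnj (f x))" "alg_norm C0_space = (\<lambda>f. SUP x. cmod (f x))"
  by (simp_all add: C0_space_def fun_alg_def)

lemma C_sphere_simps:
  "alg_carrier C_sphere = cont_funs (sphere 0 1)" "alg_scale C_sphere = (\<lambda>c f x. c * f x)"
  "alg_star C_sphere = (\<lambda>f x. cnj (f x))" "alg_norm C_sphere = (\<lambda>f. SUP x. cmod (f x))"
  by (simp_all add: C_sphere_def fun_alg_def)

lemma shell_module_simps:
  "mod_carrier (shell_module n \<epsilon>) = c0_funs (cyl \<epsilon>)"
  "mod_scale (shell_module n \<epsilon>) = (\<lambda>c \<psi> p. c * \<psi> p)"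
  "mod_act (shell_module n \<epsilon>) = (\<lambda>\<psi> h p. \<psi> p * h (emb p))"
  "mod_ip (shell_module n \<epsilon>) = shell_ip n \<epsilon>"
  by (simp_all add: shell_module_def)

lemma shell_module_act_c0_funs:
  assumes "\<psi> \<in> c0_funs (cyl \<epsilon>)" "h \<in> c0_funs UNIV"
  shows "(\<lambda>p. \<psi> p * h (emb p)) \<in> c0_funs (cyl \<epsilon>)"
proof -
  obtain M where M: "\<And>x. cmod (h x) \<le> M" using c0_funs_bounded[OF assms(2)] by blast
  have "continuous_on (cyl \<epsilon>) (\<lambda>p. h (emb p))"
    by (rule continuous_on_compose2[OF c0_funsD(1)[OF assms(2)]])
      (auto simp: emb_def case_prod_unfold intro!: continuous_intros)
  then show ?thesis using c0_funs_mult[OF assms(1) _ M] by (simp add: mult.commute)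
qed

lemma hilbert_module_shell:
  assumes "0 < \<epsilon>" "\<epsilon> < 1"
  shows "hilbert_module C0_space
    (shell_module n \<epsilon> :: ((real^'d) \<times> real \<Rightarrow> complex, (real^'d) \<Rightarrow> complex) right_module)"
    (is "hilbert_module C0_space ?E")
proof -
  interpret B: cstar_algebra "C0_space :: ((real^'d) \<Rightarrow> complex) star_alg"
    by (rule cstar_algebra_C0_space)
  have vs: "vector_space (mod_scale ?E)"
    unfolding shell_module_simps by (rule vector_space_pointwise)
  interpret E: vector_space "mod_scale ?E" by (rule vs)
  show ?thesis
  proof (rule hilbert_module.intro[OF cstar_algebra_C0_space vs hilbert_module_axioms.intro],
      unfold shell_module_simps C0_space_simps)
    show "module.subspace (\<lambda>c \<psi> p. c * \<psi> p) (c0_funs (cyl \<epsilon>))" by (rule subspace_c0_funs)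
    show "complete_wrt (\<lambda>\<psi>. sqrt (SUP x. cmod (shell_ip n \<epsilon> \<psi> \<psi> x))) (c0_funs (cyl \<epsilon>))"
      using shell_norm_complete[OF assms, of n] by (simp add: shell_norm_def[abs_def])
    fix \<psi> \<phi> \<xi> :: "(real^'d) \<times> real \<Rightarrow> complex" and h h' :: "(real^'d) \<Rightarrow> complex" and c :: complex
    show "(\<lambda>p. (\<psi> + \<phi>) p * h (emb p)) = (\<lambda>p. \<psi> p * h (emb p)) + (\<lambda>p. \<phi> p * h (emb p))"
      "(\<lambda>p. \<psi> p * (h + h') (emb p)) = (\<lambda>p. \<psi> p * h (emb p)) + (\<lambda>p. \<psi> p * h' (emb p))"
      "(\<lambda>p. c * \<psi> p * h (emb p)) = (\<lambda>p. c * (\<psi> p * h (emb p)))"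
      "(\<lambda>p. \<psi> p * (c * h (emb p))) = (\<lambda>p. c * (\<psi> p * h (emb p)))"
      "(\<lambda>p. \<psi> p * h (emb p) * h' (emb p)) = (\<lambda>p. \<psi> p * (h * h') (emb p))"
      by (rule ext; simp add: algebra_simps)+
    show "shell_ip n \<epsilon> \<psi> (\<phi> + \<xi>) = shell_ip n \<epsilon> \<psi> \<phi> + shell_ip n \<epsilon> \<psi> \<xi>"
      "shell_ip n \<epsilon> \<psi> (\<lambda>p. c * \<phi> p) = (\<lambda>x. c * shell_ip n \<epsilon> \<psi> \<phi> x)"
      "(\<lambda>x. cnj (shell_ip n \<epsilon> \<psi> \<phi> x)) = shell_ip n \<epsilon> \<phi> \<psi>"
      by (rule ext; simp add: shell_ip_def algebra_simps add_divide_distrib)+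
    \<comment> \<open>The right action evaluates h at \<open>emb\<close> of the preimage of x, which
      is x itself on the shell; off the shell both sides vanish.\<close>
    show "shell_ip n \<epsilon> \<psi> (\<lambda>p. \<phi> p * h (emb p)) = shell_ip n \<epsilon> \<psi> \<phi> * h"
      by (rule ext) (simp add: shell_ip_def f_inv_into_f)
    assume \<psi>: "\<psi> \<in> c0_funs (cyl \<epsilon>)"
    show "(\<lambda>p. \<psi> p * h (emb p)) \<in> c0_funs (cyl \<epsilon>)" if "h \<in> c0_funs UNIV"
      using \<psi> that by (rule shell_module_act_c0_funs)
    show "shell_ip n \<epsilon> \<psi> \<phi> \<in> c0_funs UNIV" if "\<phi> \<in> c0_funs (cyl \<epsilon>)"
      using assms(2) \<psi> that by (rule shell_ip_c0_funs)
    show "\<psi> = 0" if "shell_ip n \<epsilon> \<psi> \<psi> = 0"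
    proof
      fix p
      show "\<psi> p = 0 p"
        using shell_norm_pointwise[OF assms(2) \<psi>, of p n] c0_funsD(2)[OF \<psi>, of p] that
        by (cases "p \<in> cyl \<epsilon>") (simp_all add: shell_norm_def)
    qed
    \<comment> \<open>The square root of the inner product is the push-forward of \<open>\<psi>\<close> with half the weight.\<close>
    define c where "c = push \<epsilon> (\<lambda>p. of_real (1 / sqrt ((snd p + 1) ^ n)) * \<psi> p)"
    have "(\<lambda>p. of_real (1 / sqrt ((snd p + 1) ^ n)) * \<psi> p) \<in> c0_funs (cyl \<epsilon>)"
      by (rule weighted_c0_funs[where w = "\<lambda>r. 1 / sqrt (r ^ n)"])
        (use assms \<psi> in \<open>auto intro!: continuous_intros\<close>)
    then have "c \<in> c0_funs UNIV" unfolding c_def by (rule push_c0_funs[OF assms(2)])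
    moreover have "shell_ip n \<epsilon> \<psi> \<psi> = (\<lambda>x. cnj (c x)) * c"
    proof
      fix x
      show "shell_ip n \<epsilon> \<psi> \<psi> x = ((\<lambda>x. cnj (c x)) * c) x"
      proof (cases "x \<in> emb ` cyl \<epsilon>")
        case True
        then obtain p where p: "p \<in> cyl \<epsilon>" "x = emb p" by blast
        have "sqrt ((snd p + 1) ^ n) * sqrt ((snd p + 1) ^ n) = (snd p + 1) ^ n"
          using assms p by (auto simp: cyl_def)
        then have "1 / (snd p + 1) ^ n = 1 / sqrt ((snd p + 1) ^ n) * (1 / sqrt ((snd p + 1) ^ n))"
          by simp
        then show ?thesis
          using p by (simp only: shell_ip_emb[OF assms(2)] push_emb[OF assms(2)] c_def
              times_fun_apply complex_cnj_mult complex_cnj_complex_of_real of_real_mult mult_ac)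
      qed (simp add: shell_ip_outside push_def c_def)
    qed
    ultimately show "B.positive (shell_ip n \<epsilon> \<psi> \<psi>)"
      unfolding B.positive_def C0_space_simps by blast
  qed
qed


section \<open>The operator\<close>

locale shell =
  fixes n :: nat and \<epsilon> :: real
    and E :: "((real^'d::finite) \<times> real \<Rightarrow> complex, (real^'d) \<Rightarrow> complex) right_module"
  assumes \<epsilon>_pos: "0 < \<epsilon>" and \<epsilon>_less_1: "\<epsilon> < 1" and E_eq: "E = shell_module n \<epsilon>"
begin

sublocale hilbert_module C0_space E
  unfolding E_eq using \<epsilon>_pos \<epsilon>_less_1 by (rule hilbert_module_shell)

abbreviation X :: "((real^'d) \<times> real) set" where "X \<equiv> cyl \<epsilon>"

abbreviation f :: "(real^'d) \<times> real \<Rightarrow> real" where "f p \<equiv> tan_potential \<epsilon> (snd p)"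

lemma E_simps:
  "mod_carrier E = c0_funs X" "mod_scale E = (\<lambda>c \<psi> p. c * \<psi> p)"
  "mod_act E = (\<lambda>\<psi> h p. \<psi> p * h (emb p))" "mod_ip E = shell_ip n \<epsilon>"
  by (simp_all add: E_eq shell_module_simps)

lemma mnorm_eq: "mnorm = shell_norm n \<epsilon>"
  by (rule ext) (simp add: mnorm_def shell_norm_def E_simps C0_space_simps)

section \<open>Norm estimates and multiplication operators on the module\<close>

text \<open>The weight at a point is the same on both sides, so pointwise domination passes to the
  norm. Compactness and the commutator bounds are reduced to this.\<close>

lemma mnorm_mono:
  assumes "\<phi> \<in> c0_funs X" "M \<ge> 0" "\<And>p. p \<in> X \<Longrightarrow> cmod (\<psi> p) \<le> M * cmod (\<phi> p)"
  shows "mnorm \<psi> \<le> M * mnorm \<phi>"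
  unfolding mnorm_eq
proof (rule shell_norm_le[OF \<epsilon>_less_1])
  show "0 \<le> M * shell_norm n \<epsilon> \<phi>"
    using assms \<epsilon>_less_1 by (simp add: shell_norm_nonneg)
  fix p assume p: "p \<in> X"
  have "cmod (\<psi> p) \<le> M * cmod (\<phi> p)" using p by (rule assms(3))
  also have "\<dots> \<le> M * (shell_norm n \<epsilon> \<phi> * sqrt ((snd p + 1) ^ n))"
    using assms p \<epsilon>_less_1 by (intro mult_left_mono shell_norm_pointwise) auto
  finally show "cmod (\<psi> p) \<le> M * shell_norm n \<epsilon> \<phi> * sqrt ((snd p + 1) ^ n)"
    by (simp add: mult.assoc)
qed

lemma mnorm_tendsto_pointwise:
  assumes "(\<lambda>k. mnorm (\<Psi> k - \<psi>)) \<longlonglongrightarrow> 0" "\<And>k. \<Psi> k \<in> c0_funs X" "\<psi> \<in> c0_funs X" "p \<in> X"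
  shows "(\<lambda>k. \<Psi> k p) \<longlonglongrightarrow> \<psi> p"
proof -
  have "(\<lambda>k. \<Psi> k p - \<psi> p) \<longlonglongrightarrow> 0"
  proof (rule Lim_null_comparison)
    show "\<forall>\<^sub>F k in sequentially. norm (\<Psi> k p - \<psi> p) \<le> mnorm (\<Psi> k - \<psi>) * sqrt ((snd p + 1) ^ n)"
      using shell_norm_pointwise[OF \<epsilon>_less_1 c0_funs_diff[OF assms(2,3)] assms(4)]
      by (intro always_eventually allI) (simp add: mnorm_eq fun_diff_def)
    show "(\<lambda>k. mnorm (\<Psi> k - \<psi>) * sqrt ((snd p + 1) ^ n)) \<longlonglongrightarrow> 0"
      by (rule tendsto_mult_left_zero[OF assms(1)])
  qed
  then show ?thesis by (simp add: LIM_zero_iff)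
qed

text \<open>Evaluation at \<open>emb p\<close> and division by the nonzero weight; this is how the
  defining relation of the adjoint becomes a pointwise equation.\<close>

lemma shell_ip_eqD:
  assumes "shell_ip n \<epsilon> \<psi> \<phi> = shell_ip n \<epsilon> \<psi>' \<phi>'" "p \<in> X"
  shows "cnj (\<psi> p) * \<phi> p = cnj (\<psi>' p) * \<phi>' p"
proof -
  have "snd p + 1 \<noteq> 0" using assms(2) \<epsilon>_less_1 by (auto simp: cyl_def)
  then have "complex_of_real (1 / (snd p + 1) ^ n) \<noteq> 0"
    by (metis divide_eq_0_iff of_real_eq_0_iff power_not_zero zero_neq_one)
  moreover have "of_real (1 / (snd p + 1) ^ n) * (cnj (\<psi> p) * \<phi> p)
      = of_real (1 / (snd p + 1) ^ n) * (cnj (\<psi>' p) * \<phi>' p)"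
    using fun_cong[OF assms(1), of "emb p"]
    unfolding shell_ip_emb[OF \<epsilon>_less_1 assms(2)] mult.assoc .
  ultimately show ?thesis by (rule mult_left_cancel[THEN iffD1])
qed

lemma adjoint_pair_mult:
  assumes "continuous_on X m" "\<And>p. p \<in> X \<Longrightarrow> cmod (m p) \<le> M"
  shows "adjoint_pair (\<lambda>\<psi> p. m p * \<psi> p) (\<lambda>\<psi> p. cnj (m p) * \<psi> p)"
  unfolding adjoint_pair_def E_simps
proof (intro conjI ballI)
  show "(\<lambda>\<psi> p. m p * \<psi> p) ` c0_funs X \<subseteq> c0_funs X"
    using assms by (auto intro!: c0_funs_mult[where M = M])
  show "(\<lambda>\<psi> p. cnj (m p) * \<psi> p) ` c0_funs X \<subseteq> c0_funs X"
    using assms by (auto intro!: c0_funs_mult[where M = M] continuous_intros)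
  show "shell_ip n \<epsilon> (\<lambda>p. m p * \<psi> p) \<phi> = shell_ip n \<epsilon> \<psi> (\<lambda>p. cnj (m p) * \<phi> p)" for \<psi> \<phi>
    by (rule ext) (simp add: shell_ip_def)
qed

text \<open>One rank one operator suffices: with a cutoff \<open>v\<close> that is 1 where \<open>e \<le> cmod (k p)\<close> and
  \<open>u = r\<^sup>n k\<close>, the operator \<open>rank_one u v\<close> is multiplication by \<open>k v\<close>.\<close>

lemma compact_op_mult:
  assumes k: "k \<in> c0_funs X"
  shows "compact_op (\<lambda>\<psi> p. k p * \<psi> p)"
  unfolding compact_op_def
proof (intro conjI allI impI)
  obtain M where "\<And>p. cmod (k p) \<le> M" using c0_funs_bounded[OF k] by blast
  then show "adjointable (\<lambda>\<psi> p. k p * \<psi> p)"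
    unfolding adjointable_def using adjoint_pair_mult c0_funsD(1)[OF k] by blast
  fix e :: real assume e: "e > 0"
  define u where "u = (\<lambda>p. of_real ((snd p + 1) ^ n) * k p)"
  define w where "w = (\<lambda>p. min 1 (cmod (k p) / e))"
  have u: "u \<in> c0_funs X"
    unfolding u_def using \<epsilon>_less_1 k
    by (rule weighted_c0_funs[where w = "\<lambda>r. r ^ n"]) (intro continuous_intros)
  have v: "(\<lambda>p. complex_of_real (w p)) \<in> c0_funs X"
  proof (rule c0_funsI)
    show "continuous_on X (\<lambda>p. complex_of_real (w p))"
      unfolding w_def using c0_funsD(1)[OF k] e by (intro continuous_intros) auto
    show "complex_of_real (w p) = 0" if "p \<notin> X" for p
      using c0_funsD(2)[OF k that] by (simp add: w_def)
    fix d :: real assume d: "d > 0"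
    have "d * e \<le> cmod (k p)" if "d \<le> cmod (complex_of_real (w p))" for p
      using that e by (simp add: w_def pos_le_divide_eq)
    then show "\<exists>K. compact K \<and> K \<subseteq> X \<and> {p \<in> X. d \<le> cmod (complex_of_real (w p))} \<subseteq> K"
      using c0_funsD(3)[OF k, of "d * e"] d e
      by (intro exI[of _ "{p \<in> X. d * e \<le> cmod (k p)}"]) auto
  qed
  have "mnorm ((\<lambda>p. k p * \<xi> p) - (\<Sum>i<1::nat. rank_one u (\<lambda>p. of_real (w p)) \<xi>)) \<le> e * mnorm \<xi>"
    if \<xi>: "\<xi> \<in> c0_funs X" for \<xi>
  proof (rule mnorm_mono[OF \<xi>])
    fix p assume p: "p \<in> X"
    have "snd p + 1 \<noteq> 0" using p \<epsilon>_less_1 by (auto simp: cyl_def)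
    then have "complex_of_real (snd p) + 1 \<noteq> 0"
      by (metis of_real_1 of_real_add of_real_eq_0_iff)
    then have "rank_one u (\<lambda>p. of_real (w p)) \<xi> p = k p * of_real (w p) * \<xi> p"
      using p \<epsilon>_less_1 by (simp add: rank_one_def E_simps shell_ip_emb u_def)
    then have "((\<lambda>p. k p * \<xi> p) - (\<Sum>i<1::nat. rank_one u (\<lambda>p. of_real (w p)) \<xi>)) p
        = k p * of_real (1 - w p) * \<xi> p"
      by (simp add: algebra_simps)
    moreover have "cmod (k p * of_real (1 - w p)) \<le> e"
    proof (cases "cmod (k p) \<le> e")
      case True
      have "0 \<le> w p" "w p \<le> 1" using e by (auto simp: w_def)
      then have "cmod (k p) * (1 - w p) \<le> cmod (k p) * 1" by (intro mult_left_mono) auto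
      then show ?thesis using True \<open>w p \<le> 1\<close> by (simp add: norm_mult del: of_real_diff)
    next
      case False
      then have "w p = 1" using e by (simp add: w_def)
      then show ?thesis using e by simp
    qed
    ultimately show "cmod (((\<lambda>p. k p * \<xi> p) - (\<Sum>i<1::nat. rank_one u (\<lambda>p. of_real (w p)) \<xi>)) p)
        \<le> e * cmod (\<xi> p)"
      by (metis mult_right_mono norm_ge_zero norm_mult)
  qed (use e in simp)
  then show "\<exists>(m::nat) u v. (\<forall>i<m. u i \<in> mod_carrier E \<and> v i \<in> mod_carrier E) \<and>
      (\<forall>\<xi>\<in>mod_carrier E.
        mnorm ((\<lambda>p. k p * \<xi> p) - (\<Sum>i<m. rank_one (u i) (v i) \<xi>)) \<le> e * mnorm \<xi>)"
    using u v unfolding E_simps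
    by (intro exI[of _ "1 :: nat"] exI[of _ "\<lambda>_. u"] exI[of _ "\<lambda>_ p. of_real (w p)"]
        conjI allI impI ballI)
qed

section \<open>The potential and the resolvent functions\<close>

lemma S_op_eq: "S_op \<epsilon> \<psi> = (\<lambda>p. of_real (f p) * \<psi> p)"
  by (auto simp: S_op_def)

lemma sphere_act_eq: "sphere_act g \<psi> = (\<lambda>p. g (fst p) * \<psi> p)"
  by (auto simp: sphere_act_def)

text \<open>For |s| < \<epsilon> the argument of the tangent stays strictly between -pi/2 and pi/2,
  where the cosine is positive.\<close>

lemma continuous_on_potential: "continuous_on X f"
proof -
  have cos: "cos (pi / (2 * \<epsilon>) * s) \<noteq> 0" if "-\<epsilon> < s" "s < \<epsilon>" for s
  proof -
    have "\<bar>s\<bar> / \<epsilon> < 1" using that \<epsilon>_pos by auto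
    then have "pi / 2 * (\<bar>s\<bar> / \<epsilon>) < pi / 2 * 1" by (intro mult_strict_left_mono) auto
    then have "\<bar>pi / (2 * \<epsilon>) * s\<bar> < pi / 2" using \<epsilon>_pos by (simp add: abs_mult)
    then show ?thesis using cos_gt_zero_pi[of "pi / (2 * \<epsilon>) * s"] by linarith
  qed
  have "continuous_on X (\<lambda>p. tan (pi / (2 * \<epsilon>) * snd p))"
    unfolding tan_def by (intro continuous_intros ballI cos) (auto simp: cyl_def)
  then show ?thesis unfolding tan_potential_def Let_def by (rule continuous_on_mult_left)
qed

text \<open>This is the properness of f, the source of the decay of \<open>res\<close> at
  infinity.\<close>

lemma compact_potential_le: "\<exists>K. compact K \<and> K \<subseteq> X \<and> {p \<in> X. \<bar>f p\<bar> \<le> M} \<subseteq> K"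
proof -
  define \<alpha> where "\<alpha> = pi / (2 * \<epsilon>)"
  have \<alpha>: "\<alpha> > 0" "\<alpha> * \<epsilon> = pi / 2" using \<epsilon>_pos by (auto simp: \<alpha>_def)
  \<comment> \<open>The solution of \<alpha> tan(\<alpha> b) = M; since arctan stays below pi/2, b
    lies below \<epsilon>, and the cylinder over [-b, b] is a compact subset of X.\<close>
  define b where "b = arctan (M / \<alpha>) / \<alpha>"
  have "b * \<alpha> < \<epsilon> * \<alpha>" using \<alpha> arctan_ubound[of "M / \<alpha>"] by (simp add: b_def mult.commute)
  then have b: "b < \<epsilon>" using \<alpha> by simp
  have "\<bar>s\<bar> \<le> b" if s: "\<bar>s\<bar> < \<epsilon>" "\<bar>tan_potential \<epsilon> s\<bar> \<le> M" for s
  proof -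
    have "\<alpha> * \<bar>s\<bar> < \<alpha> * \<epsilon>" using s \<alpha> by simp
    then have "\<bar>\<alpha> * s\<bar> < pi / 2" using \<alpha> by (simp add: abs_mult)
    then have arctan: "arctan (tan (\<alpha> * s)) = \<alpha> * s" by (intro arctan_tan) auto
    have "\<alpha> * \<bar>tan (\<alpha> * s)\<bar> \<le> M"
      using s \<alpha> by (simp add: tan_potential_def \<alpha>_def abs_mult)
    then have "\<bar>tan (\<alpha> * s)\<bar> \<le> M / \<alpha>" using \<alpha> by (simp add: pos_le_divide_eq mult.commute)
    then have "arctan (tan (\<alpha> * s)) \<le> arctan (M / \<alpha>)" "arctan (- tan (\<alpha> * s)) \<le> arctan (M / \<alpha>)"
      unfolding arctan_le_iff by linarith+
    then have "\<bar>\<alpha> * s\<bar> \<le> arctan (M / \<alpha>)" by (simp add: arctan arctan_minus)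
    then show ?thesis using \<alpha> by (simp add: b_def pos_le_divide_eq abs_mult mult.commute)
  qed
  then have "{p \<in> X. \<bar>f p\<bar> \<le> M} \<subseteq> sphere 0 1 \<times> {-b..b}"
    by (auto simp: cyl_def abs_less_iff abs_le_iff minus_le_iff)
  moreover have "sphere 0 1 \<times> {-b..b} \<subseteq> X" using b by (auto simp: cyl_def)
  moreover have "compact (sphere (0 :: real^'d) 1 \<times> {-b..b})" by (intro compact_Times) auto
  ultimately show ?thesis by blast
qed

text \<open>For nonreal z the quotient has no zeros even off the cylinder, so the zero extension has
  to be built in.\<close>

definition res :: "complex \<Rightarrow> (real^'d) \<times> real \<Rightarrow> complex" where
  "res z p = (if p \<in> X then 1 / (of_real (f p) - z) else 0)"

lemma potential_minus_nonreal: "Im z \<noteq> 0 \<Longrightarrow> complex_of_real (f p) - z \<noteq> 0"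
  by (auto simp: complex_eq_iff)

text \<open>If e <= 1 / |f - z| then |f| <= 1 / e + |z|, so superlevel sets lie in sublevel sets of
  |f|, which properness traps in compact sets.\<close>

lemma res_c0_funs:
  assumes "Im z \<noteq> 0"
  shows "res z \<in> c0_funs X"
proof (rule c0_funsI)
  have "continuous_on X (\<lambda>p. 1 / (complex_of_real (f p) - z))"
    using continuous_on_potential potential_minus_nonreal[OF assms]
    by (intro continuous_intros) auto
  then show "continuous_on X (res z)" by (rule continuous_on_eq) (simp add: res_def)
  show "res z p = 0" if "p \<notin> X" for p using that by (simp add: res_def)
  fix e :: real assume e: "e > 0"
  obtain K where K: "compact K" "K \<subseteq> X" "{p \<in> X. \<bar>f p\<bar> \<le> 1 / e + cmod z} \<subseteq> K"
    using compact_potential_le by blast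
  have "\<bar>f p\<bar> \<le> 1 / e + cmod z" if "p \<in> X" "e \<le> cmod (res z p)" for p
  proof -
    have "cmod (of_real (f p) - z) > 0" using potential_minus_nonreal[OF assms] by simp
    then have "cmod (of_real (f p) - z) \<le> 1 / e"
      using that e by (simp add: res_def norm_divide pos_le_divide_eq mult.commute)
    then show ?thesis using norm_triangle_ineq2[of "of_real (f p)" z] by simp
  qed
  then show "\<exists>K. compact K \<and> K \<subseteq> X \<and> {p \<in> X. e \<le> cmod (res z p)} \<subseteq> K" using K by blast
qed

lemma potential_res: "Im z \<noteq> 0 \<Longrightarrow> p \<in> X \<Longrightarrow> of_real (f p) * res z p = 1 + z * res z p"
  using potential_minus_nonreal[of z p] by (simp add: res_def field_simps)

lemma S_op_res:
  assumes "Im z \<noteq> 0" "\<phi> \<in> c0_funs X"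
  shows "S_op \<epsilon> (\<lambda>p. res z p * \<phi> p) = (\<lambda>p. \<phi> p + z * (res z p * \<phi> p))"
proof
  fix p
  show "S_op \<epsilon> (\<lambda>p. res z p * \<phi> p) p = \<phi> p + z * (res z p * \<phi> p)"
  proof (cases "p \<in> X")
    case True
    have "S_op \<epsilon> (\<lambda>p. res z p * \<phi> p) p = (of_real (f p) * res z p) * \<phi> p"
      by (simp add: S_op_eq)
    then show ?thesis unfolding potential_res[OF assms(1) True] by (simp add: algebra_simps)
  next
    case False
    then show ?thesis using c0_funsD(2)[OF assms(2)] by (simp add: S_op_eq)
  qed
qed

lemma res_S_dom:
  assumes "Im z \<noteq> 0" "\<phi> \<in> c0_funs X"
  shows "(\<lambda>p. res z p * \<phi> p) \<in> S_dom \<epsilon>"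
  unfolding S_dom_def mem_Collect_eq S_op_res[OF assms]
  using assms by (intro conjI c0_funs_add c0_funs_scale c0_funs_times res_c0_funs)

lemma S_dom_c0: "\<psi> \<in> S_dom \<epsilon> \<Longrightarrow> \<psi> \<in> c0_funs X" "\<psi> \<in> S_dom \<epsilon> \<Longrightarrow> S_op \<epsilon> \<psi> \<in> c0_funs X"
  by (auto simp: S_dom_def)

section \<open>Density of the domain, self-adjointness and regularity\<close>

text \<open>The error is psi times f / (f - i t). Where |psi| is small, the quotient is at most 1 in
  modulus; on the compact rest f is bounded, so a large t makes the quotient small.\<close>

lemma dense_S_dom: "dense_wrt mnorm (c0_funs X) (S_dom \<epsilon>)"
  unfolding dense_wrt_def
proof (intro conjI ballI allI impI)
  show "S_dom \<epsilon> \<subseteq> c0_funs X" by (auto simp: S_dom_def)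
  fix \<psi> and e :: real assume \<psi>: "\<psi> \<in> c0_funs X" and e: "e > 0"
  \<comment> \<open>Scaled so that \<open>shell_norm_le_bound\<close> turns the pointwise bound d
    into e / 2, leaving room for the strict inequality.\<close>
  define d where "d = e / 2 * sqrt ((1 - \<epsilon>) ^ n)"
  have d: "d > 0" using e \<epsilon>_less_1 by (simp add: d_def)
  obtain B where B: "B > 0" "\<And>p. cmod (\<psi> p) \<le> B" using c0_funs_bounded[OF \<psi>] by blast
  have "compact (f ` {p \<in> X. d \<le> cmod (\<psi> p)})"
    using c0_funsD(3)[OF \<psi> d] continuous_on_potential
    by (intro compact_continuous_image) (auto intro: continuous_on_subset)
  then have "bounded (f ` {p \<in> X. d \<le> cmod (\<psi> p)})" by (rule compact_imp_bounded)
  then obtain M where M: "M > 0" "\<And>p. p \<in> X \<Longrightarrow> d \<le> cmod (\<psi> p) \<Longrightarrow> \<bar>f p\<bar> \<le> M"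
    unfolding bounded_pos by auto
  \<comment> \<open>Chosen so that (M / t) B = d, which bounds the error where |psi| >= d.\<close>
  define t where "t = M * B / d"
  have t: "t > 0" using M B d by (simp add: t_def)
  \<comment> \<open>The approximant is \<open>- z (S - z)\<^sup>-\<^sup>1 \<psi>\<close> at \<open>z = i t\<close>, whose difference from \<open>\<psi>\<close> is
    \<open>S (S - z)\<^sup>-\<^sup>1 \<psi>\<close>.\<close>
  define w where "w = (\<lambda>p. res (\<i> * of_real t) p * (- (\<i> * of_real t) * \<psi> p))"
  have Im: "Im (\<i> * of_real t) \<noteq> 0" using t by simp
  have "w \<in> S_dom \<epsilon>" unfolding w_def using \<psi> by (intro res_S_dom c0_funs_scale Im)
  moreover have "mnorm (\<psi> - w) < e"
  proof -
    have "cmod ((\<psi> - w) p) \<le> d" if p: "p \<in> X" for p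
    proof -
      let ?q = "of_real (f p) - \<i> * of_real t :: complex"
      have q: "?q \<noteq> 0" using potential_minus_nonreal[OF Im] .
      have "(\<psi> - w) p = of_real (f p) / ?q * \<psi> p"
        using p q by (simp add: w_def res_def field_simps)
      then have eq: "cmod ((\<psi> - w) p) = \<bar>f p\<bar> / cmod ?q * cmod (\<psi> p)"
        by (simp add: norm_mult norm_divide)
      show ?thesis
      proof (cases "d \<le> cmod (\<psi> p)")
        case True
        have "t \<le> cmod ?q" using abs_Im_le_cmod[of ?q] t by simp
        then have "\<bar>f p\<bar> / cmod ?q \<le> M / t"
          using M(2)[of p] True p t by (intro frac_le) auto
        then have "\<bar>f p\<bar> / cmod ?q * cmod (\<psi> p) \<le> M / t * B"
          using B M(1) t by (intro mult_mono) auto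
        also have "M / t * B = d" using M(1) B(1) d by (simp add: t_def)
        finally show ?thesis unfolding eq .
      next
        case False
        have "\<bar>f p\<bar> \<le> cmod ?q" using abs_Re_le_cmod[of ?q] by simp
        then have "\<bar>f p\<bar> / cmod ?q * cmod (\<psi> p) \<le> 1 * cmod (\<psi> p)"
          using q by (intro mult_right_mono) auto
        then show ?thesis unfolding eq using False by simp
      qed
    qed
    then have "mnorm (\<psi> - w) \<le> d / sqrt ((1 - \<epsilon>) ^ n)"
      unfolding mnorm_eq using d \<epsilon>_less_1 by (intro shell_norm_le_bound) auto
    also have "\<dots> = e / 2" using \<epsilon>_less_1 by (simp add: d_def)
    finally show ?thesis using e by simp
  qed
  ultimately show "\<exists>w\<in>S_dom \<epsilon>. mnorm (\<psi> - w) < e" by blast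
qed

lemma module_operator_S: "module_operator (S_dom \<epsilon>) (S_op \<epsilon>)"
proof -
  have add: "S_op \<epsilon> (\<psi> + \<phi>) = S_op \<epsilon> \<psi> + S_op \<epsilon> \<phi>" for \<psi> \<phi> :: "(real^'d) \<times> real \<Rightarrow> complex"
    by (rule ext) (simp add: S_op_eq algebra_simps)
  have scale: "S_op \<epsilon> (\<lambda>p. c * \<psi> p) = (\<lambda>p. c * S_op \<epsilon> \<psi> p)"
    for c and \<psi> :: "(real^'d) \<times> real \<Rightarrow> complex"
    by (rule ext) (simp add: S_op_eq)
  have act: "S_op \<epsilon> (\<lambda>p. \<psi> p * h (emb p)) = (\<lambda>p. S_op \<epsilon> \<psi> p * h (emb p))"
    for \<psi> and h :: "(real^'d) \<Rightarrow> complex"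
    by (rule ext) (simp add: S_op_eq)
  have "(0 :: (real^'d) \<times> real \<Rightarrow> complex) \<in> S_dom \<epsilon>"
    by (simp add: S_dom_def S_op_eq zero_fun_def c0_funs_zero)
  moreover have "\<psi> + \<phi> \<in> S_dom \<epsilon>" if "\<psi> \<in> S_dom \<epsilon>" "\<phi> \<in> S_dom \<epsilon>"
    for \<psi> \<phi> :: "(real^'d) \<times> real \<Rightarrow> complex"
    using that unfolding S_dom_def by (simp add: add) (simp add: plus_fun_def c0_funs_add)
  moreover have "(\<lambda>p. c * \<psi> p) \<in> S_dom \<epsilon>" if "\<psi> \<in> S_dom \<epsilon>"
    for c and \<psi> :: "(real^'d) \<times> real \<Rightarrow> complex"
    using that unfolding S_dom_def by (simp add: scale c0_funs_scale)
  moreover have "(\<lambda>p. \<psi> p * h (emb p)) \<in> S_dom \<epsilon>" if "\<psi> \<in> S_dom \<epsilon>" "h \<in> c0_funs UNIV"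
    for \<psi> and h :: "(real^'d) \<Rightarrow> complex"
    using that unfolding S_dom_def by (simp add: act shell_module_act_c0_funs)
  ultimately show ?thesis
    unfolding module_operator_def E.subspace_def
    by (auto simp: E_simps C0_space_simps add scale act S_dom_c0)
qed

text \<open>As f is real, S is symmetric. Conversely the adjoint relation forces eta = f phi
  pointwise, and since the domain is the maximal one for multiplication by f, eta in C_0 already
  says that phi belongs to it.\<close>

lemma adjoint_graph_S: "adjoint_graph (S_dom \<epsilon>) (S_op \<epsilon>) = op_graph (S_dom \<epsilon>) (S_op \<epsilon>)"
proof (intro equalityI subsetI)
  fix x assume "x \<in> op_graph (S_dom \<epsilon>) (S_op \<epsilon>)"
  then obtain \<phi> where \<phi>: "\<phi> \<in> S_dom \<epsilon>" "x = (\<phi>, S_op \<epsilon> \<phi>)" by (auto simp: op_graph_def)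
  have "shell_ip n \<epsilon> (S_op \<epsilon> \<psi>) \<phi> = shell_ip n \<epsilon> \<psi> (S_op \<epsilon> \<phi>)" for \<psi>
    by (rule ext) (simp add: shell_ip_def S_op_eq)
  then show "x \<in> adjoint_graph (S_dom \<epsilon>) (S_op \<epsilon>)"
    using \<phi> by (simp add: adjoint_graph_def E_simps S_dom_c0)
next
  fix x assume "x \<in> adjoint_graph (S_dom \<epsilon>) (S_op \<epsilon>)"
  then obtain \<phi> \<eta> where x: "x = (\<phi>, \<eta>)" "\<phi> \<in> c0_funs X" "\<eta> \<in> c0_funs X"
    "\<And>\<psi>. \<psi> \<in> S_dom \<epsilon> \<Longrightarrow> shell_ip n \<epsilon> (S_op \<epsilon> \<psi>) \<phi> = shell_ip n \<epsilon> \<psi> \<eta>"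
    by (auto simp: adjoint_graph_def E_simps)
  \<comment> \<open>Testing against an element of the domain without zeros determines \<open>\<eta>\<close>.\<close>
  have "\<eta> p = S_op \<epsilon> \<phi> p" for p
  proof (cases "p \<in> X")
    case True
    \<comment> \<open>\<open>res_S_dom\<close> asks for a second factor vanishing at infinity, which
      the constant 1 does not; \<open>res \<i>\<close> itself serves and has no zeros on X.\<close>
    let ?\<psi> = "\<lambda>p. res \<i> p * res \<i> p"
    have "?\<psi> \<in> S_dom \<epsilon>" by (intro res_S_dom res_c0_funs) auto
    then have "cnj (S_op \<epsilon> ?\<psi> p) * \<phi> p = cnj (?\<psi> p) * \<eta> p"
      by (intro shell_ip_eqD x(4) True)
    then have "cnj (?\<psi> p) * (of_real (f p) * \<phi> p) = cnj (?\<psi> p) * \<eta> p"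
      by (simp add: S_op_eq mult_ac)
    \<comment> \<open>Conjugation turns f - i into f + i, so nonvanishing is used at both
      \<open>\<i>\<close> and \<open>- \<i>\<close>.\<close>
    moreover have "cnj (?\<psi> p) \<noteq> 0"
      using True potential_minus_nonreal[of \<i> p] potential_minus_nonreal[of "- \<i>" p]
      by (simp add: res_def)
    ultimately have "of_real (f p) * \<phi> p = \<eta> p" by (metis mult_left_cancel)
    then show ?thesis by (simp add: S_op_eq)
  next
    case False
    then show ?thesis by (simp add: S_op_eq c0_funsD(2)[OF x(2)] c0_funsD(2)[OF x(3)])
  qed
  then have "\<eta> = S_op \<epsilon> \<phi>" by (rule ext)
  then show "x \<in> op_graph (S_dom \<epsilon>) (S_op \<epsilon>)"
    using x by (auto simp: op_graph_def S_dom_def)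
qed

lemma self_adjoint_S: "self_adjoint (S_dom \<epsilon>) (S_op \<epsilon>)"
  unfolding self_adjoint_def densely_defined_def E_simps adjoint_graph_S
  using module_operator_S dense_S_dom by simp

text \<open>Norm convergence implies pointwise convergence, so the limit eta equals f psi at every
  point; maximality of the domain again puts psi in it.\<close>

lemma closed_op_S: "closed_op (S_dom \<epsilon>) (S_op \<epsilon>)"
  unfolding closed_op_def E_simps
proof (intro allI impI, elim conjE)
  fix \<Psi> \<psi> \<eta>
  assume \<Psi>: "\<forall>k::nat. \<Psi> k \<in> S_dom \<epsilon>" and c0: "\<psi> \<in> c0_funs X" "\<eta> \<in> c0_funs X"
    and lim: "(\<lambda>k. mnorm (\<Psi> k - \<psi>)) \<longlonglongrightarrow> 0" "(\<lambda>k. mnorm (S_op \<epsilon> (\<Psi> k) - \<eta>)) \<longlonglongrightarrow> 0"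
  have "\<eta> p = S_op \<epsilon> \<psi> p" for p
  proof (cases "p \<in> X")
    case True
    have "(\<lambda>k. \<Psi> k p) \<longlonglongrightarrow> \<psi> p"
      using \<Psi> by (intro mnorm_tendsto_pointwise lim c0 True S_dom_c0) simp
    then have "(\<lambda>k. of_real (f p) * \<Psi> k p) \<longlonglongrightarrow> of_real (f p) * \<psi> p"
      by (rule tendsto_mult_left)
    then have "(\<lambda>k. S_op \<epsilon> (\<Psi> k) p) \<longlonglongrightarrow> S_op \<epsilon> \<psi> p" by (simp add: S_op_eq)
    moreover have "(\<lambda>k. S_op \<epsilon> (\<Psi> k) p) \<longlonglongrightarrow> \<eta> p"
      using \<Psi> by (intro mnorm_tendsto_pointwise lim c0 True S_dom_c0) simp
    ultimately show ?thesis by (rule LIMSEQ_unique[symmetric])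
  next
    case False
    then show ?thesis by (simp add: S_op_eq c0_funsD(2)[OF c0(1)] c0_funsD(2)[OF c0(2)])
  qed
  then have "\<eta> = S_op \<epsilon> \<psi>" by (rule ext)
  then show "(\<psi>, \<eta>) \<in> op_graph (S_dom \<epsilon>) (S_op \<epsilon>)"
    using c0 by (auto simp: op_graph_def S_dom_def)
qed

text \<open>\<open>1 + S\<^sup>2\<close> is even onto, with inverse \<open>(S - i)\<^sup>-\<^sup>1 (S + i)\<^sup>-\<^sup>1\<close>.\<close>

lemma regular_S: "regular (S_dom \<epsilon>) (S_op \<epsilon>)"
proof -
  have "\<exists>\<psi> \<eta>. \<phi> = \<psi> + \<eta> \<and> \<psi> \<in> S_dom \<epsilon> \<and> (S_op \<epsilon> \<psi>, \<eta>) \<in> op_graph (S_dom \<epsilon>) (S_op \<epsilon>)"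
    if \<phi>: "\<phi> \<in> c0_funs X" for \<phi>
  proof -
    \<comment> \<open>Solves (S + i) zeta = phi and then (S - i) psi = zeta. As S psi = zeta + i psi
      is a sum of elements of the domain, S may be applied a second time.\<close>
    define \<zeta> where "\<zeta> = (\<lambda>p. res (- \<i>) p * \<phi> p)"
    define \<psi> where "\<psi> = (\<lambda>p. res \<i> p * \<zeta> p)"
    have \<zeta>: "\<zeta> \<in> S_dom \<epsilon>" "S_op \<epsilon> \<zeta> = (\<lambda>p. \<phi> p + - \<i> * \<zeta> p)"
      unfolding \<zeta>_def using \<phi> by (auto intro: res_S_dom simp: S_op_res)
    then have \<psi>: "\<psi> \<in> S_dom \<epsilon>" "S_op \<epsilon> \<psi> = (\<lambda>p. \<zeta> p + \<i> * \<psi> p)"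
      unfolding \<psi>_def by (auto intro!: res_S_dom S_op_res S_dom_c0)
    have "\<zeta> + (\<lambda>p. \<i> * \<psi> p) \<in> S_dom \<epsilon>"
      using module_operator_S \<zeta>(1) \<psi>(1) E.subspace_scale[of "S_dom \<epsilon>" \<psi> \<i>]
      by (intro E.subspace_add) (simp_all add: module_operator_def E_simps(2))
    then have "S_op \<epsilon> \<psi> \<in> S_dom \<epsilon>" by (simp add: \<psi>(2) plus_fun_def)
    moreover have "\<phi> = \<psi> + S_op \<epsilon> (S_op \<epsilon> \<psi>)"
    proof
      fix p
      have "S_op \<epsilon> (\<lambda>p. \<zeta> p + \<i> * \<psi> p) p = S_op \<epsilon> \<zeta> p + \<i> * S_op \<epsilon> \<psi> p"
        by (simp add: S_op_eq algebra_simps)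
      then have "S_op \<epsilon> (S_op \<epsilon> \<psi>) p = S_op \<epsilon> \<zeta> p + \<i> * S_op \<epsilon> \<psi> p"
        unfolding \<psi>(2)[symmetric] .
      then show "\<phi> p = (\<psi> + S_op \<epsilon> (S_op \<epsilon> \<psi>)) p"
        unfolding \<zeta>(2) \<psi>(2) by (simp add: algebra_simps)
    qed
    ultimately show ?thesis using \<psi>(1) unfolding op_graph_def by blast
  qed
  then have "{\<psi> + \<eta> |\<psi> \<eta>. \<psi> \<in> S_dom \<epsilon> \<and> (S_op \<epsilon> \<psi>, \<eta>) \<in> op_graph (S_dom \<epsilon>) (S_op \<epsilon>)} = c0_funs X"
    by (auto simp: op_graph_def plus_fun_def intro: c0_funs_add[OF S_dom_c0(1) S_dom_c0(2)])
  moreover have "dense_wrt mnorm (c0_funs X) (c0_funs X)"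
  proof -
    \<comment> \<open>With factor 0 the domination estimate says that the zero vector has norm at
      most 0.\<close>
    have "mnorm 0 \<le> 0 * mnorm 0"
      by (rule mnorm_mono) (simp_all add: zero_fun_def c0_funs_zero)
    then have "mnorm (\<psi> - \<psi>) < e" if "e > 0" for \<psi> :: "(real^'d) \<times> real \<Rightarrow> complex" and e
      using that by (simp only: diff_self mult_zero_left)
    then show ?thesis unfolding dense_wrt_def by blast
  qed
  moreover have "fst ` op_graph (S_dom \<epsilon>) (S_op \<epsilon>) = S_dom \<epsilon>"
    by (force simp: op_graph_def)
  ultimately show ?thesis
    unfolding regular_def densely_defined_def E_simps adjoint_graph_S
    using module_operator_S closed_op_S dense_S_dom by simp
qed

lemma is_resolvent_res:
  assumes "Im z \<noteq> 0"
  shows "is_resolvent (S_dom \<epsilon>) (S_op \<epsilon>) z (\<lambda>\<psi> p. res z p * \<psi> p)"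
  unfolding is_resolvent_def E_simps
proof (intro conjI ballI)
  show "adjointable (\<lambda>\<psi> p. res z p * \<psi> p)"
    using compact_op_mult[OF res_c0_funs[OF assms]] by (simp add: compact_op_def)
  show "(\<lambda>\<psi> p. res z p * \<psi> p) ` c0_funs X \<subseteq> S_dom \<epsilon>"
    using res_S_dom[OF assms] by blast
  show "S_op \<epsilon> (\<lambda>p. res z p * \<phi> p) - (\<lambda>p. z * (res z p * \<phi> p)) = \<phi>" if "\<phi> \<in> c0_funs X" for \<phi>
    unfolding S_op_res[OF assms that] by (rule ext) simp
  show "(\<lambda>p. res z p * (S_op \<epsilon> \<psi> - (\<lambda>p. z * \<psi> p)) p) = \<psi>" if "\<psi> \<in> S_dom \<epsilon>" for \<psi>
  proof
    fix p
    show "res z p * (S_op \<epsilon> \<psi> - (\<lambda>p. z * \<psi> p)) p = \<psi> p"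
      using potential_minus_nonreal[OF assms, of p] c0_funsD(2)[OF S_dom_c0(1)[OF that], of p]
      by (cases "p \<in> X") (simp_all add: res_def S_op_eq flip: left_diff_distrib)
  qed
qed

section \<open>The action of C(S^n) and the cycle\<close>

lemma sphere_fun_on_shell:
  assumes "g \<in> cont_funs (sphere 0 1)"
  obtains M where "continuous_on X (\<lambda>p. g (fst p))" "\<And>p. p \<in> X \<Longrightarrow> cmod (g (fst p)) \<le> M"
proof -
  have g: "g \<in> c0_funs (sphere 0 1)" using assms by (simp add: c0_funs_compact)
  have "continuous_on X (\<lambda>p. g (fst p))"
    by (rule continuous_on_compose2[OF c0_funsD(1)[OF g]])
      (auto simp: cyl_def intro!: continuous_intros)
  moreover obtain M where "\<And>x. cmod (g x) \<le> M" using c0_funs_bounded[OF g] by blast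
  ultimately show ?thesis using that by blast
qed

lemma sphere_act_c0_funs:
  assumes "g \<in> cont_funs (sphere 0 1)" "\<psi> \<in> c0_funs X"
  shows "sphere_act g \<psi> \<in> c0_funs X"
proof -
  obtain M where M: "continuous_on X (\<lambda>p. g (fst p))" "\<And>p. p \<in> X \<Longrightarrow> cmod (g (fst p)) \<le> M"
    using sphere_fun_on_shell[OF assms(1)] by blast
  show ?thesis unfolding sphere_act_eq using assms(2) M by (rule c0_funs_mult)
qed

lemma S_op_sphere_act:
  fixes \<psi> :: "(real^'d) \<times> real \<Rightarrow> complex"
  shows "S_op \<epsilon> (sphere_act g \<psi>) = sphere_act g (S_op \<epsilon> \<psi>)"
  by (rule ext) (simp add: S_op_eq sphere_act_eq)

lemma kasparov_cycle:
  "odd_unbounded_kasparov_cycle (C_sphere :: ((real^'d) \<Rightarrow> complex) star_alg)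
     C0_space E sphere_act (S_dom \<epsilon>) (S_op \<epsilon>)"
proof (intro odd_unbounded_kasparov_cycle.intro cstar_algebra_C_sphere hilbert_module_axioms
    odd_unbounded_kasparov_cycle_axioms.intro)
  interpret A: cstar_algebra "C_sphere :: ((real^'d) \<Rightarrow> complex) star_alg"
    by (rule cstar_algebra_C_sphere)
  show "self_adjoint (S_dom \<epsilon>) (S_op \<epsilon>)" by (rule self_adjoint_S)
  show "regular (S_dom \<epsilon>) (S_op \<epsilon>)" by (rule regular_S)
  show "\<exists>R. is_resolvent (S_dom \<epsilon>) (S_op \<epsilon>) z R \<and>
      (\<forall>g\<in>alg_carrier C_sphere. compact_op (\<lambda>\<psi>. sphere_act g (R \<psi>)))" if "Im z \<noteq> 0" for z
  proof (intro exI conjI ballI)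
    show "is_resolvent (S_dom \<epsilon>) (S_op \<epsilon>) z (\<lambda>\<psi> p. res z p * \<psi> p)"
      using that by (rule is_resolvent_res)
    fix g :: "(real^'d) \<Rightarrow> complex" assume "g \<in> alg_carrier C_sphere"
    \<comment> \<open>Acting by g after the resolvent is multiplication by one function, g times
      \<open>res z\<close>, which is again in C_0.\<close>
    then have "sphere_act g (res z) \<in> c0_funs X"
      using that by (simp add: C_sphere_simps sphere_act_c0_funs res_c0_funs)
    then show "compact_op (\<lambda>\<psi>. sphere_act g (\<lambda>p. res z p * \<psi> p))"
      unfolding sphere_act_eq mult.assoc[symmetric] by (rule compact_op_mult)
  qed
  show "\<exists>\<A>. A.dense_star_subalgebra \<A> \<and> (\<forall>g\<in>\<A>. sphere_act g ` S_dom \<epsilon> \<subseteq> S_dom \<epsilon> \<and>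
      (\<exists>C. \<forall>\<psi>\<in>S_dom \<epsilon>. mnorm (S_op \<epsilon> (sphere_act g \<psi>) - sphere_act g (S_op \<epsilon> \<psi>)) \<le> C * mnorm \<psi>))"
  proof (intro exI conjI ballI)
    \<comment> \<open>All of C(S^n) serves as the dense subalgebra: multiplication operators
      commute, so every commutator is zero.\<close>
    show "A.dense_star_subalgebra (alg_carrier C_sphere)"
      unfolding A.dense_star_subalgebra_def dense_wrt_def
      using A.carrier_subspace A.mult_closed A.star_closed A.norm_eq_0 A.subspace_0
      by (metis diff_self subset_refl)
    fix g :: "(real^'d) \<Rightarrow> complex" assume g: "g \<in> alg_carrier C_sphere"
    then show "sphere_act g ` S_dom \<epsilon> \<subseteq> S_dom \<epsilon>"
      by (auto simp: S_dom_def S_op_sphere_act C_sphere_simps sphere_act_c0_funs)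
    show "mnorm (S_op \<epsilon> (sphere_act g \<psi>) - sphere_act g (S_op \<epsilon> \<psi>)) \<le> 0 * mnorm \<psi>"
      if "\<psi> \<in> S_dom \<epsilon>" for \<psi>
      using that by (intro mnorm_mono S_dom_c0) (auto simp: S_op_sphere_act)
  qed
  fix g g' :: "(real^'d) \<Rightarrow> complex" and \<psi> :: "(real^'d) \<times> real \<Rightarrow> complex" and c :: complex
  show "sphere_act (g + g') \<psi> = sphere_act g \<psi> + sphere_act g' \<psi>"
    "sphere_act (alg_scale C_sphere c g) \<psi> = mod_scale E c (sphere_act g \<psi>)"
    "sphere_act (g * g') \<psi> = sphere_act g (sphere_act g' \<psi>)"
    by (rule ext; simp add: sphere_act_eq C_sphere_simps E_simps algebra_simps)+
  assume "g \<in> alg_carrier C_sphere"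
  then obtain M where M: "continuous_on X (\<lambda>p. g (fst p))" "\<And>p. p \<in> X \<Longrightarrow> cmod (g (fst p)) \<le> M"
    using sphere_fun_on_shell unfolding C_sphere_simps by metis
  show "adjoint_pair (sphere_act g) (sphere_act (alg_star C_sphere g))"
    unfolding sphere_act_eq[abs_def] C_sphere_simps using M by (rule adjoint_pair_mult)
qed

end

theorem proposition2p4:
  fixes n :: nat and \<epsilon> :: real
  assumes "n \<ge> 1" and "CARD('d::finite) = n + 1" and "0 < \<epsilon>" and "\<epsilon> < 1"
  shows "odd_unbounded_kasparov_cycle
           (C_sphere :: ((real^'d) \<Rightarrow> complex) star_alg)
           (C0_space :: ((real^'d) \<Rightarrow> complex) star_alg)
           (shell_module n \<epsilon>) sphere_act (S_dom \<epsilon>) (S_op \<epsilon>)"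
proof -
  interpret shell n \<epsilon> "shell_module n \<epsilon>" using assms by unfold_locales auto
  show ?thesis by (rule kasparov_cycle)
qed

end
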